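(* Let $(X,T)$ be a topological dynamical system, let $\mathbf{F}=\{\mathbf{f}_n\}_{n=1}^\infty$ be a block sub-additive potential on $X$, and let $\mathcal{U}\in\mathcal{C}_X^o$ be an open cover of $X$. Then $$GP(T,\mathbf{F},\mathcal{U})=\max_{\mu\in M(X,T)}GP_\mu(T,\mathbf{F},\mathcal{U}).$$
   Context: A topological dynamical system (TDS) $(X,T)$ is a compact metric space $X$ with metric $d$ together with a continuous surjective map $T:X\to X$. $C(Z)$ is the space of real-valued continuous functions on $Z$; $M(X)$ is the set of Borel probability measures on $X$, and $M(X,T)$ is the subset of $T$-invariant ones. A block sub-additive potential on $X$ is a sequence $\mathbf{F}=\{\mathbf{f}_n\}_{n=1}^\infty$ with $\mathbf{f}_n\in C(X^n)$ such that $\mathbf{f}_{n+m}(x_0,\ldots,x_{n+m-1})\le \mathbf{f}_n(x_0,\ldots,x_{n-1})+\mathbf{f}_m(x_n,\ldots,x_{n+m-1})$ for all $m,n\ge 1$ and all $x_0,\ldots,x_{n+m-1}\in X$. Covers: for a subset $K$ of a compact metric space $Z$, a cover of $K$ is a finite family of Borel subsets of $K$ (restrictions to $K$ of Borel sets of $Z$) whose union is $K$; $\mathcal{C}_K$ is the set of all covers of $K$, and $\mathcal{C}_K^o$ the set of those consisting of relatively open sets. For $\mathcal{V}\in\mathcal{C}_K$ and $\mathcal{W}\in\mathcal{C}_Z$, $\mathcal{V}\succeq\mathcal{W}$ means every element of $\mathcal{V}$ is contained in some element of $\mathcal{W}$. For $\mathcal{U}\in\mathcal{C}_X$, $\mathcal{U}^n=\{U_1\times\cdots\times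 U_n: U_i\in\mathcal{U}\}\in\mathcal{C}_{X^n}$. Average pseudo-orbits: for $\delta>0$ (and $n\ge2$), $X^n_\delta$ is the set of $(x_0,\ldots,x_{n-1})\in X^n$ with $\frac{1}{n-1}\sum_{i=0}^{n-2}d(Tx_i,x_{i+1})\le\delta$. Topological pressure: $GP_{n,\delta}(T,\mathbf{F},\mathcal{U})=\inf\{\sum_{V\in\mathcal{V}}\sup_{\mathbf{x}\in V}e^{\mathbf{f}_n(\mathbf{x})}:\mathcal{V}\in\mathcal{C}_{X^n_\delta},\ \mathcal{V}\succeq\mathcal{U}^n\}$ (empty sets contribute $0$), $GP_\delta(T,\mathbf{F},\mathcal{U})=\limsup_{n\to\infty}\frac1n\log GP_{n,\delta}(T,\mathbf{F},\mathcal{U})$, and $GP(T,\mathbf{F},\mathcal{U})=\inf_{\delta>0}GP_\delta(T,\mathbf{F},\mathcal{U})$. Measure-theoretic pressure: for $\mu\in M(X)$, a finite set $L\subset C(X)$ and $\delta>0$, let $X^n_{\delta,\mu,L}$ be the set of $(x_0,\ldots,x_{n-1})\in X^n_\delta$ with $\max_{g\in L}|\frac1n\sum_{i=0}^{n-1}g(x_i)-\int g\,d\mu|\le\delta$. Put $GP_{n,\delta,\mu,L}(T,\mathbf{F},\mathcal{U})=\inf\{\sum_{V\in\mathcal{V}}\sup_{\mathbf{x}\in V}e^{\mathbf{f}_n(\mathbf{x})}:\mathcal{V}\in\mathcal{C}_{X^n_{\delta,\mu,L}},\ \mathcal{V}\succeq\mathcal{U}^n\}$, with value $0$ if $X^n_{\delta,\mu,L}=\emptyset$;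 $GP_{\delta,\mu,L}(T,\mathbf{F},\mathcal{U})=\limsup_{n\to\infty}\frac1n\log GP_{n,\delta,\mu,L}(T,\mathbf{F},\mathcal{U})$ with $\log0=-\infty$; and $GP_\mu(T,\mathbf{F},\mathcal{U})=\inf_{L}\inf_{\delta>0}GP_{\delta,\mu,L}(T,\mathbf{F},\mathcal{U})$, where $L$ ranges over finite subsets of $C(X)$. *)

theory Defs
  imports "HOL-Probability.Probability"
begin

(* The compact metric space X is the universe of a type of class metric_space (hence nonempty). *)
definition tds :: "('a::metric_space \<Rightarrow> 'a) \<Rightarrow> bool" where
  "tds T \<longleftrightarrow> compact (UNIV :: 'a set) \<and> continuous_on UNIV T \<and> surj T"

(* Points of X^n are functions on nat that are extensional on {..<n}. *)
definition pow_top :: "nat \<Rightarrow> (nat \<Rightarrow> 'a::topological_space) topology" where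
  "pow_top n = product_topology (\<lambda>_. euclidean) {..<n}"

definition block_subadditive :: "(nat \<Rightarrow> (nat \<Rightarrow> 'a::metric_space) \<Rightarrow> real) \<Rightarrow> bool" where
  "block_subadditive F \<longleftrightarrow>
     (\<forall>n\<ge>1. continuous_map (pow_top n) euclideanreal (F n)) \<and>
     (\<forall>n\<ge>1. \<forall>m\<ge>1. \<forall>x \<in> topspace (pow_top (n + m)).
        F (n + m) x \<le> F n (restrict x {..<n}) + F m (\<lambda>i\<in>{..<m}. x (n + i)))"

definition borel_sets :: "'b topology \<Rightarrow> 'b set set" where
  "borel_sets Z = sigma_sets (topspace Z) {S. openin Z S}"

definition is_cover :: "'b topology \<Rightarrow> 'b set \<Rightarrow> 'b set set \<Rightarrow> bool" where
  "is_cover Z K \<V> \<longleftrightarrow> finite \<V> \<and> (\<forall>V\<in>\<V>. \<exists>B\<in>borel_sets Z. V = B \<inter> K) \<and> \<Union>\<V> = K"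

definition is_open_cover :: "'b topology \<Rightarrow> 'b set \<Rightarrow> 'b set set \<Rightarrow> bool" where
  "is_open_cover Z K \<V> \<longleftrightarrow> is_cover Z K \<V> \<and> (\<forall>V\<in>\<V>. openin (subtopology Z K) V)"

definition finer_cover :: "'b set set \<Rightarrow> 'b set set \<Rightarrow> bool" where
  "finer_cover \<V> \<W> \<longleftrightarrow> (\<forall>V\<in>\<V>. \<exists>W\<in>\<W>. V \<subseteq> W)"

definition cover_pow :: "'a set set \<Rightarrow> nat \<Rightarrow> (nat \<Rightarrow> 'a) set set" where
  "cover_pow \<U> n = {Pi\<^sub>E {..<n} W | W. \<forall>i<n. W i \<in> \<U>}"

(* For n < 2 the average is an empty sum divided by 0, i.e. 0, so all of X^n qualifies;
   only the limit n -> infinity matters below. *)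
definition avg_pseudo_orbits ::
    "('a::metric_space \<Rightarrow> 'a) \<Rightarrow> nat \<Rightarrow> real \<Rightarrow> (nat \<Rightarrow> 'a) set" where
  "avg_pseudo_orbits T n \<delta> =
     {x \<in> topspace (pow_top n).
        (\<Sum>i<n - 1. dist (T (x i)) (x (Suc i))) / real (n - 1) \<le> \<delta>}"

definition avg_pseudo_orbits_near ::
    "('a::metric_space \<Rightarrow> 'a) \<Rightarrow> nat \<Rightarrow> real \<Rightarrow> 'a measure \<Rightarrow> ('a \<Rightarrow> real) set
     \<Rightarrow> (nat \<Rightarrow> 'a) set" where
  "avg_pseudo_orbits_near T n \<delta> \<mu> L =
     {x \<in> avg_pseudo_orbits T n \<delta>.
        \<forall>g\<in>L. \<bar>(\<Sum>i<n. g (x i)) / real n - (LINT y|\<mu>. g y)\<bar> \<le> \<delta>}"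

(* The supremum is taken in [0, infinity], so the empty set contributes 0.  For K = {} the
   empty cover is admissible, so the value is 0. *)
definition cover_sum ::
    "(nat \<Rightarrow> (nat \<Rightarrow> 'a::metric_space) \<Rightarrow> real) \<Rightarrow> 'a set set \<Rightarrow> nat \<Rightarrow> (nat \<Rightarrow> 'a) set
     \<Rightarrow> ennreal" where
  "cover_sum F \<U> n K =
     Inf {(\<Sum>V\<in>\<V>. SUP x\<in>V. ennreal (exp (F n x))) | \<V>.
            is_cover (pow_top n) K \<V> \<and> finer_cover \<V> (cover_pow \<U> n)}"

definition elog :: "ennreal \<Rightarrow> ereal" where
  "elog a = (if a = 0 then -\<infinity> else if a = \<infinity> then \<infinity> else ereal (ln (enn2real a)))"

definition GP_at ::
    "('a::metric_space \<Rightarrow> 'a) \<Rightarrow> (nat \<Rightarrow> (nat \<Rightarrow> 'a) \<Rightarrow> real) \<Rightarrow> 'a set set \<Rightarrow> real \<Rightarrow> ereal" where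
  "GP_at T F \<U> \<delta> =
     limsup (\<lambda>n. elog (cover_sum F \<U> n (avg_pseudo_orbits T n \<delta>)) / ereal (real n))"

definition GP ::
    "('a::metric_space \<Rightarrow> 'a) \<Rightarrow> (nat \<Rightarrow> (nat \<Rightarrow> 'a) \<Rightarrow> real) \<Rightarrow> 'a set set \<Rightarrow> ereal" where
  "GP T F \<U> = (INF \<delta>\<in>{0<..}. GP_at T F \<U> \<delta>)"

definition GP_measure_at ::
    "('a::metric_space \<Rightarrow> 'a) \<Rightarrow> (nat \<Rightarrow> (nat \<Rightarrow> 'a) \<Rightarrow> real) \<Rightarrow> 'a set set \<Rightarrow> real
     \<Rightarrow> 'a measure \<Rightarrow> ('a \<Rightarrow> real) set \<Rightarrow> ereal" where
  "GP_measure_at T F \<U> \<delta> \<mu> L =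
     limsup (\<lambda>n. elog (cover_sum F \<U> n (avg_pseudo_orbits_near T n \<delta> \<mu> L)) / ereal (real n))"

definition GP_measure ::
    "('a::metric_space \<Rightarrow> 'a) \<Rightarrow> (nat \<Rightarrow> (nat \<Rightarrow> 'a) \<Rightarrow> real) \<Rightarrow> 'a set set
     \<Rightarrow> 'a measure \<Rightarrow> ereal" where
  "GP_measure T F \<U> \<mu> =
     (INF L\<in>{L. finite L \<and> (\<forall>g\<in>L. continuous_on UNIV g)}.
        INF \<delta>\<in>{0<..}. GP_measure_at T F \<U> \<delta> \<mu> L)"

definition inv_prob_measures :: "('a::metric_space \<Rightarrow> 'a) \<Rightarrow> 'a measure set" where
  "inv_prob_measures T =
     {\<mu>. sets \<mu> = sets borel \<and> prob_space \<mu> \<and> distr \<mu> borel T = \<mu>}"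

end

(* The inequality GP_mu <= GP is the choice L = {}.  For the converse, every point of X^n defines the
   functional g |-> (1/n) sum g(x_i), and these functionals live in a compact product of intervals.
   If every functional in that product had a neighbourhood whose pseudo-orbits grow at a rate below GP
   (or do not exist for large n), finitely many neighbourhoods would cover all pseudo-orbits, and finite
   subadditivity of the cover sums would contradict the definition of GP.  A functional Lambda that
   survives is a limit of empirical averages along average pseudo-orbits, hence linear, positive,
   normalized and T-invariant, and the Riesz representation theorem turns it into an invariant
   measure mu with GP <= GP_mu. *)
theory Submission
  imports Defs
begin

subsection \<open>Riesz representation on a compact metric space\<close>

text \<open>\<open>GP_measure\<close> sees a measure only through its integrals of continuous
  functions, so functionals can stand in for measures until the very end. A functional is total on
  all real functions, but only its values at continuous ones carry information; discontinuous
  coordinates are pinned to 0 so that the product stays compact. The delicate case is GP =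
  -\<infinity>: no rate lies strictly below it, and every functional satisfies the required
  inequality, even one that no pseudo-orbit approximates. Survival therefore also demands nearby
  pseudo-orbits for infinitely many n, and this is what yields linearity and invariance. The second
  obstacle is that jumps are small only on average, so a modulus of continuity cannot be applied
  jump by jump. A bound |g a - g b| \<le> e + C d(a,b) can be summed along the orbit instead. The
  measure comes from a Daniell-type outer measure. The construction gives directly only that the
  integral is at most the functional; equality follows by applying this to f and to 1 - f.\<close>

locale normalized_positive_functional =
  fixes \<Lambda> :: "('a::metric_space \<Rightarrow> real) \<Rightarrow> real"
  assumes compact_UNIV: "compact (UNIV :: 'a set)"
    and add: "continuous_on UNIV f \<Longrightarrow> continuous_on UNIV g \<Longrightarrow> \<Lambda> (\<lambda>x. f x + g x) = \<Lambda> f + \<Lambda> g"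
    and scale: "continuous_on UNIV f \<Longrightarrow> \<Lambda> (\<lambda>x. c * f x) = c * \<Lambda> f"
    and nonneg: "continuous_on UNIV f \<Longrightarrow> (\<And>x. 0 \<le> f x) \<Longrightarrow> 0 \<le> \<Lambda> f"
    and one: "\<Lambda> (\<lambda>_. 1) = 1"
begin

lemma const: "\<Lambda> (\<lambda>_. c) = c"
  using scale[of "\<lambda>_. 1" c] by (simp add: one)

lemma diff:
  assumes "continuous_on UNIV f" "continuous_on UNIV g"
  shows "\<Lambda> (\<lambda>x. f x - g x) = \<Lambda> f - \<Lambda> g"
  using add[of "\<lambda>x. f x - g x" g] assms by (simp add: continuous_on_diff)

lemma mono:
  assumes "continuous_on UNIV f" "continuous_on UNIV g" "\<And>x. f x \<le> g x"
  shows "\<Lambda> f \<le> \<Lambda> g"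
  using nonneg[of "\<lambda>x. g x - f x"] diff[of g f] assms by (simp add: continuous_on_diff)

lemma sum:
  assumes "finite I" "\<And>i. i \<in> I \<Longrightarrow> continuous_on UNIV (f i)"
  shows "\<Lambda> (\<lambda>x. \<Sum>i\<in>I. f i x) = (\<Sum>i\<in>I. \<Lambda> (f i))"
  using assms by (induction I) (simp_all add: const add continuous_on_sum)

section \<open>The outer measure generated by a positive functional\<close>

definition nonneg_seq :: "(nat \<Rightarrow> 'a \<Rightarrow> real) \<Rightarrow> bool" where
  "nonneg_seq f \<longleftrightarrow> (\<forall>k. continuous_on UNIV (f k) \<and> (\<forall>x. 0 \<le> f k x))"

lemma nonneg_seq_cont: "nonneg_seq f \<Longrightarrow> continuous_on UNIV (f k)"
  and nonneg_seq_nonneg: "nonneg_seq f \<Longrightarrow> 0 \<le> f k x"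
  and nonneg_seq_functional: "nonneg_seq f \<Longrightarrow> 0 \<le> \<Lambda> (f k)"
  unfolding nonneg_seq_def by (auto intro: nonneg)

(* Dini's argument: by compactness finitely many terms dominate g up to e. *)
lemma functional_le_suminf:
  assumes f: "nonneg_seq f" and g: "continuous_on UNIV g"
    and le: "\<And>x. ennreal (g x) \<le> (\<Sum>k. ennreal (f k x))"
  shows "ennreal (\<Lambda> g) \<le> (\<Sum>k. ennreal (\<Lambda> (f k)))"
proof (rule ennreal_le_epsilon)
  fix e :: real assume e: "0 < e"
  define W where "W N = {x. g x - e < (\<Sum>k<N. f k x)}" for N
  have op: "open (W N)" for N
    unfolding W_def by (intro open_Collect_less continuous_intros g nonneg_seq_cont[OF f])
  have "\<exists>N. x \<in> W N" for x
  \<comment> \<open>\<open>ennreal\<close> truncates negative numbers to 0, so a negative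
    \<open>g x - e\<close> is treated apart: there the empty partial sum already exceeds it.\<close>
  proof (cases "g x - e < 0")
    case True
    then have "x \<in> W 0" by (simp add: W_def)
    then show ?thesis ..
  next
    case False
    have "ennreal (g x - e) < ennreal (g x)"
      using False e by (intro ennreal_lessI) auto
    also have "\<dots> \<le> (SUP N. \<Sum>k<N. ennreal (f k x))"
      using le[of x] by (simp add: suminf_eq_SUP)
    finally obtain N where "ennreal (g x - e) < (\<Sum>k<N. ennreal (f k x))"
      by (auto simp: less_SUP_iff)
    then have "ennreal (g x - e) < ennreal (\<Sum>k<N. f k x)"
      by (simp add: sum_ennreal nonneg_seq_nonneg[OF f])
    then have "x \<in> W N"
      using False by (simp add: W_def ennreal_less_iff)
    then show ?thesis ..
  qed
  then have cov: "UNIV \<subseteq> \<Union>(range W)" by auto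
  obtain C where C: "finite C" "UNIV \<subseteq> (\<Union>N\<in>C. W N)"
    by (rule compactE_image[OF compact_UNIV, of UNIV W]) (use op cov in auto)
  define M where "M = Max (insert 0 C)"
  have dom: "g x \<le> (\<Sum>k<M. f k x) + e" for x
  proof -
    obtain N where N: "N \<in> C" "x \<in> W N" using C by auto
    have "(\<Sum>k<N. f k x) \<le> (\<Sum>k<M. f k x)"
      using N C by (intro sum_mono2) (auto simp: M_def nonneg_seq_nonneg[OF f] intro: order.strict_trans2)
    then show ?thesis using N by (simp add: W_def)
  qed
  have "\<Lambda> g \<le> \<Lambda> (\<lambda>x. (\<Sum>k<M. f k x) + e)"
    by (intro mono dom g continuous_intros nonneg_seq_cont[OF f])
  also have "\<dots> = (\<Sum>k<M. \<Lambda> (f k)) + e"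
    by (subst add) (auto simp: const sum nonneg_seq_cont[OF f] intro!: continuous_intros)
  finally have "ennreal (\<Lambda> g) \<le> ennreal ((\<Sum>k<M. \<Lambda> (f k)) + e)"
    by (rule ennreal_leI)
  also have "\<dots> = (\<Sum>k<M. ennreal (\<Lambda> (f k))) + ennreal e"
    using e by (simp add: sum_ennreal nonneg_seq_functional[OF f] sum_nonneg)
  also have "\<dots> \<le> (\<Sum>k. ennreal (\<Lambda> (f k))) + ennreal e"
    by (intro add_right_mono sum_le_suminf) auto
  finally show "ennreal (\<Lambda> g) \<le> (\<Sum>k. ennreal (\<Lambda> (f k))) + ennreal e" .
qed

text \<open>Daniell's upper integral of the indicator of A. Competitors are countable series rather
  than single functions, because this builds countable subadditivity into the definition; summing in
  [0, \<infinity>] lets a competitor diverge.\<close>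

definition outer :: "'a set \<Rightarrow> ennreal" where
  "outer A = (INF f\<in>{f. nonneg_seq f \<and> (\<forall>x\<in>A. 1 \<le> (\<Sum>k. ennreal (f k x)))}. \<Sum>k. ennreal (\<Lambda> (f k)))"

lemma outer_le:
  assumes "nonneg_seq f" "\<And>x. x \<in> A \<Longrightarrow> 1 \<le> (\<Sum>k. ennreal (f k x))"
  shows "outer A \<le> (\<Sum>k. ennreal (\<Lambda> (f k)))"
  unfolding outer_def using assms by (intro INF_lower) auto

text \<open>A double family becomes a single competitor by enumerating pairs of indices; in
  [0, \<infinity>] the order of summation does not matter.\<close>

lemma outer_le_double:
  assumes f: "\<And>k. nonneg_seq (f k)" and ge: "\<And>x. x \<in> A \<Longrightarrow> 1 \<le> (\<Sum>k. \<Sum>n. ennreal (f k n x))"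
  shows "outer A \<le> (\<Sum>k. \<Sum>n. ennreal (\<Lambda> (f k n)))"
proof -
  define h where "h j = (case prod_decode j of (k, n) \<Rightarrow> f k n)" for j
  have "nonneg_seq h"
    using f by (auto simp: nonneg_seq_def h_def split: prod.split)
  moreover have "(\<Sum>j. ennreal (h j x)) = (\<Sum>k. \<Sum>n. ennreal (f k n x))" for x
    using suminf_ennreal_2dimen[of "\<lambda>k. \<Sum>n. ennreal (f k n x)" "\<lambda>(k, n). ennreal (f k n x)"]
    by (simp add: h_def split_def)
  moreover have "(\<Sum>j. ennreal (\<Lambda> (h j))) = (\<Sum>k. \<Sum>n. ennreal (\<Lambda> (f k n)))"
    using suminf_ennreal_2dimen[of "\<lambda>k. \<Sum>n. ennreal (\<Lambda> (f k n))" "\<lambda>(k, n). ennreal (\<Lambda> (f k n))"]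
    by (simp add: h_def split_def)
  ultimately show ?thesis using outer_le[of h A] ge by simp
qed

lemma suminf_single: "(\<Sum>k. ennreal (if k = 0 then c else 0)) = ennreal c"
  by (subst suminf_finite[of "{0::nat}"]) auto

lemma outer_le_single:
  assumes f: "continuous_on UNIV f" "\<And>x. 0 \<le> f x" "\<And>x. x \<in> A \<Longrightarrow> 1 \<le> f x"
  shows "outer A \<le> ennreal (\<Lambda> f)"
proof -
  let ?f = "\<lambda>k::nat. if k = 0 then f else (\<lambda>_. 0)"
  have "nonneg_seq ?f"
    using f by (auto simp: nonneg_seq_def)
  moreover have "(\<Sum>k. ennreal (?f k x)) = ennreal (f x)" for x
    using suminf_single[of "f x"] by (simp add: if_distribR cong: if_cong)
  moreover have "(\<Sum>k. ennreal (\<Lambda> (?f k))) = ennreal (\<Lambda> f)"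
    using suminf_single[of "\<Lambda> f"] by (simp add: if_distrib[of \<Lambda>] const cong: if_cong)
  ultimately show ?thesis using outer_le[of ?f A] f(3) by simp
qed

lemma outer_empty: "outer {} = 0"
  using outer_le_single[of "\<lambda>_. 0" "{}"] by (simp add: const)

lemma outer_mono: "A \<subseteq> B \<Longrightarrow> outer A \<le> outer B"
  unfolding outer_def by (rule INF_superset_mono) auto

text \<open>The constant 1 bounds from above. For the lower bound, any competitor dominates 1
  everywhere, and compactness, through \<open>functional_le_suminf\<close>, prevents its total cost
  from dropping below \<Lambda> 1 = 1.\<close>

lemma outer_UNIV: "outer UNIV = 1"
proof (rule antisym)
  show "outer UNIV \<le> 1"
    using outer_le_single[of "\<lambda>_. 1" UNIV] by (simp add: one)
  show "1 \<le> outer UNIV"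
    unfolding outer_def
  proof (rule INF_greatest, clarsimp)
    fix f assume "nonneg_seq f" "\<forall>x. 1 \<le> (\<Sum>k. ennreal (f k x))"
    then show "1 \<le> (\<Sum>k. ennreal (\<Lambda> (f k)))"
      using functional_le_suminf[of f "\<lambda>_. 1"] by (simp add: one)
  qed
qed

text \<open>Near-optimal competitors for the A n, with errors e / 2^(n+1), are merged into one by
  \<open>outer_le_double\<close>.\<close>

lemma countably_subadditive_outer: "countably_subadditive UNIV outer"
  unfolding countably_subadditive_def
proof (intro allI impI)
  fix A :: "nat \<Rightarrow> 'a set"
  show "outer (\<Union>i. A i) \<le> (\<Sum>i. outer (A i))"
  proof (rule ennreal_le_epsilon)
    fix e :: real assume "0 < e" "(\<Sum>i. outer (A i)) < top"
    then have "\<And>n. outer (A n) < outer (A n) + e * (1/2)^Suc n"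
      by (auto simp add: less_top dest!: ennreal_suminf_lessD)
    then have "\<exists>f. nonneg_seq f \<and> (\<forall>x\<in>A n. 1 \<le> (\<Sum>k. ennreal (f k x))) \<and>
        (\<Sum>k. ennreal (\<Lambda> (f k))) < outer (A n) + e * (1/2)^Suc n" for n
      unfolding outer_def INF_less_iff mem_Collect_eq Bex_def by (simp only: conj_assoc)
    then obtain f where f: "\<And>n. nonneg_seq (f n)"
      "\<And>n x. x \<in> A n \<Longrightarrow> 1 \<le> (\<Sum>k. ennreal (f n k x))"
      "\<And>n. (\<Sum>k. ennreal (\<Lambda> (f n k))) < outer (A n) + e * (1/2)^Suc n"
      by metis
    have "outer (\<Union>i. A i) \<le> (\<Sum>n. \<Sum>k. ennreal (\<Lambda> (f n k)))"
    proof (rule outer_le_double[OF f(1)])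
      fix x assume "x \<in> (\<Union>i. A i)"
      then obtain i where "x \<in> A i" by auto
      then have "1 \<le> (\<Sum>k. ennreal (f i k x))" by (rule f)
      also have "\<dots> \<le> (\<Sum>n. \<Sum>k. ennreal (f n k x))"
        using sum_le_suminf[of "\<lambda>n. \<Sum>k. ennreal (f n k x)" "{i}"] by auto
      finally show "1 \<le> (\<Sum>n. \<Sum>k. ennreal (f n k x))" .
    qed
    also have "\<dots> \<le> (\<Sum>n. outer (A n) + e * (1/2) ^ Suc n)"
      by (intro suminf_le less_imp_le[OF f(3)]) auto
    also have "\<dots> = (\<Sum>n. outer (A n)) + (\<Sum>n. ennreal e * ennreal ((1/2) ^ Suc n))"
      using \<open>0 < e\<close> by (subst suminf_add[symmetric])
                       (auto simp del: ennreal_suminf_cmult simp add: ennreal_mult[symmetric])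
    also have "\<dots> = (\<Sum>n. outer (A n)) + e"
      unfolding ennreal_suminf_cmult
      by (subst suminf_ennreal_eq[OF zero_le_power power_half_series]) auto
    finally show "outer (\<Union>i. A i) \<le> (\<Sum>n. outer (A n)) + e" .
  qed
qed

lemma outer_measure_space_outer: "outer_measure_space (Pow UNIV) outer"
  using countably_subadditive_outer
  by (auto simp: outer_measure_space_def positive_def increasing_def outer_empty intro: outer_mono)

text \<open>Competitors in \<open>outer\<close> are series, so an increasing limit must be presented
  through its increments.\<close>

lemma suminf_telescope:
  fixes h :: "nat \<Rightarrow> real"
  assumes "incseq h" "h 0 = 0"
  shows "(\<Sum>n. ennreal (h (Suc n) - h n)) = (SUP N. ennreal (h N))"
proof -
  have "(\<Sum>n<N. ennreal (h (Suc n) - h n)) = ennreal (h N)" for N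
    using assms by (subst sum_ennreal) (auto simp: incseq_SucD sum_lessThan_telescope)
  then show ?thesis by (simp add: suminf_eq_SUP)
qed

(* The truncations h N of the distance to C increase to the indicator of -C
   and vanish on C; they split any competitor f into f * h N and f * (1 - h N). *)
lemma outer_split_closed:
  assumes "closed C"
  shows "outer (A - C) + outer (A \<inter> C) \<le> outer A"
\<comment> \<open>\<open>infdist x {}\<close> is 0 by convention, so for empty C the truncations
  below would vanish instead of tending to 1 off C.\<close>
proof (cases "C = {}")
  case True
  then show ?thesis by (simp add: outer_empty)
next
  case False
  define h where "h N x = min 1 (real N * infdist x C)" for N :: nat and x
  have h01: "0 \<le> h N x" "h N x \<le> 1" "h 0 x = 0" for N x
    by (auto simp: h_def infdist_nonneg)
  have hinc: "h N x \<le> h M x" if "N \<le> M" for N M x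
    using that unfolding h_def by (intro min.mono mult_right_mono) (auto simp: infdist_nonneg)
  have hC: "h N x = 0" if "x \<in> C" for N x
    using that by (simp add: h_def)
  have hcont: "continuous_on UNIV (h N)" for N
    unfolding h_def by (intro continuous_intros)
  have hlim: "\<exists>N. h N x = 1" if "x \<notin> C" for x
  proof -
    have "infdist x C > 0"
      using infdist_pos_not_in_closed[OF assms False that] .
    then obtain N :: nat where "1 < N * infdist x C"
      using reals_Archimedean3 by blast
    then have "h N x = 1" by (simp add: h_def)
    then show ?thesis ..
  qed
  show ?thesis
    unfolding outer_def[of A]
  proof (rule INF_greatest, clarsimp)
    fix f assume f: "nonneg_seq f" and ge: "\<forall>x\<in>A. 1 \<le> (\<Sum>k. ennreal (f k x))"
    note fc = nonneg_seq_cont[OF f] and fn = nonneg_seq_nonneg[OF f]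
    have inc: "incseq (\<lambda>N. \<Lambda> (\<lambda>x. f k x * h N x))" for k
      by (auto simp: incseq_def intro!: mono continuous_intros fc hcont mult_left_mono hinc fn)
    \<comment> \<open>The increments of f k * h n in n form the double competitor: off C some h N
      equals 1, so summing over n restores at least f k.\<close>
    have "outer (A - C) \<le> (\<Sum>k. \<Sum>n. ennreal (\<Lambda> (\<lambda>x. f k x * h (Suc n) x - f k x * h n x)))"
    proof (rule outer_le_double)
      show "nonneg_seq (\<lambda>n x. f k x * h (Suc n) x - f k x * h n x)" for k
        by (auto simp: nonneg_seq_def intro!: continuous_intros fc hcont mult_left_mono hinc fn)
      fix x assume x: "x \<in> A - C"
      obtain N where N: "h N x = 1" using hlim x by auto
      have "ennreal (f k x) \<le> (\<Sum>n. ennreal (f k x * h (Suc n) x - f k x * h n x))" for k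
        by (subst suminf_telescope)
           (auto simp: incseq_def h01 N intro!: SUP_upper2[of N] mult_left_mono hinc fn)
      then have "(\<Sum>k. ennreal (f k x)) \<le> (\<Sum>k. \<Sum>n. ennreal (f k x * h (Suc n) x - f k x * h n x))"
        by (intro suminf_le) auto
      then show "1 \<le> (\<Sum>k. \<Sum>n. ennreal (f k x * h (Suc n) x - f k x * h n x))"
        using ge x by (meson DiffD1 order_trans)
    qed
    also have "\<dots> = (\<Sum>k. SUP N. ennreal (\<Lambda> (\<lambda>x. f k x * h N x)))"
    proof (rule suminf_cong)
      fix k
      have "\<Lambda> (\<lambda>x. f k x * h (Suc n) x - f k x * h n x)
          = \<Lambda> (\<lambda>x. f k x * h (Suc n) x) - \<Lambda> (\<lambda>x. f k x * h n x)" for n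
        by (intro diff continuous_intros fc hcont)
      then show "(\<Sum>n. ennreal (\<Lambda> (\<lambda>x. f k x * h (Suc n) x - f k x * h n x)))
          = (SUP N. ennreal (\<Lambda> (\<lambda>x. f k x * h N x)))"
        using suminf_telescope[OF inc[of k]] by (simp add: h01 const)
    qed
    also have "\<dots> = (SUP N. \<Sum>k. ennreal (\<Lambda> (\<lambda>x. f k x * h N x)))"
      using inc by (intro ennreal_suminf_SUP_eq) (auto simp: incseq_def intro!: ennreal_leI)
    finally have 1: "outer (A - C) \<le> (SUP N. \<Sum>k. ennreal (\<Lambda> (\<lambda>x. f k x * h N x)))" .
    \<comment> \<open>For fixed N the remainder f * (1 - h N) competes for A \<inter> C, where h N
      vanishes. The two parts add up exactly to the cost of f, and only afterwards is the supremum
      over N taken.\<close>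
    have 2: "(\<Sum>k. ennreal (\<Lambda> (\<lambda>x. f k x * h N x))) + outer (A \<inter> C) \<le> (\<Sum>k. ennreal (\<Lambda> (f k)))" for N
    proof -
      have ns: "nonneg_seq (\<lambda>k x. f k x - f k x * h N x)"
        using h01 fn by (auto simp: nonneg_seq_def mult_left_le intro!: continuous_intros fc hcont)
      have le: "outer (A \<inter> C) \<le> (\<Sum>k. ennreal (\<Lambda> (\<lambda>x. f k x - f k x * h N x)))"
        using ge by (intro outer_le[OF ns]) (auto simp: hC)
      have "ennreal (\<Lambda> (\<lambda>x. f k x * h N x)) + ennreal (\<Lambda> (\<lambda>x. f k x - f k x * h N x)) = ennreal (\<Lambda> (f k))" for k
      proof -
        have "0 \<le> \<Lambda> (\<lambda>x. f k x * h N x)"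
          by (intro nonneg continuous_intros fc hcont mult_nonneg_nonneg fn h01)
        moreover have "\<Lambda> (\<lambda>x. f k x - f k x * h N x) = \<Lambda> (f k) - \<Lambda> (\<lambda>x. f k x * h N x)"
          by (intro diff continuous_intros fc hcont)
        ultimately show ?thesis
          using nonneg_seq_functional[OF ns, of k] by (simp flip: ennreal_plus)
      qed
      then have "(\<Sum>k. ennreal (\<Lambda> (\<lambda>x. f k x * h N x))) + (\<Sum>k. ennreal (\<Lambda> (\<lambda>x. f k x - f k x * h N x)))
          = (\<Sum>k. ennreal (\<Lambda> (f k)))"
        by (subst suminf_add) auto
      then show ?thesis using add_left_mono[OF le, of "\<Sum>k. ennreal (\<Lambda> (\<lambda>x. f k x * h N x))"] by (simp only:)
    qed
    have "outer (A - C) + outer (A \<inter> C)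
        \<le> (SUP N. \<Sum>k. ennreal (\<Lambda> (\<lambda>x. f k x * h N x))) + outer (A \<inter> C)"
      by (intro add_right_mono 1)
    also have "\<dots> = (SUP N. (\<Sum>k. ennreal (\<Lambda> (\<lambda>x. f k x * h N x))) + outer (A \<inter> C))"
      by (rule ennreal_SUP_add_left[symmetric]) simp
    also have "\<dots> \<le> (\<Sum>k. ennreal (\<Lambda> (f k)))"
      by (intro SUP_least 2)
    finally show "outer (A - C) + outer (A \<inter> C) \<le> (\<Sum>k. ennreal (\<Lambda> (f k)))" .
  qed
qed

text \<open>By Caratheodory, \<open>outer\<close> is a measure on the sets that split every set
  additively. Closed sets do so by \<open>outer_split_closed\<close> and subadditivity, and they
  generate the Borel sets.\<close>

lemma measure_space_outer: "measure_space UNIV (sets borel) outer"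
proof -
  interpret sigma_algebra "UNIV :: 'a set" "Pow UNIV" by (rule sigma_algebra_Pow)
  let ?L = "lambda_system UNIV (Pow UNIV) outer"
  have ms: "measure_space UNIV ?L outer"
    by (rule caratheodory_lemma[OF outer_measure_space_outer])
  then have sa: "sigma_algebra UNIV ?L" by (simp add: measure_space_def)
  have "C \<in> ?L" if "closed C" for C
    unfolding lambda_system_eq
  proof (clarsimp, rule antisym)
    fix A
    show "outer (A \<inter> C) + outer (A - C) \<le> outer A"
      using outer_split_closed[OF that] by (simp add: add.commute)
    have "outer ((A \<inter> C) \<union> (A - C)) \<le> outer (A \<inter> C) + outer (A - C)"
    proof -
      have "subadditive (Pow UNIV) outer"
        using outer_measure_space_outer
        by (intro countably_subadditive_subadditive) (auto simp: outer_measure_space_def)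
      then show ?thesis by (rule subadditiveD) auto
    qed
    then show "outer A \<le> outer (A \<inter> C) + outer (A - C)"
      by (simp add: Int_Diff_Un)
  qed
  then have "sets borel \<subseteq> ?L"
    unfolding borel_eq_closed sets_measure_of[OF subset_UNIV[of "Collect closed", folded Pow_UNIV]]
    by (intro sigma_algebra.sigma_sets_subset[OF sa]) auto
  then show ?thesis
    by (rule measure_down[OF ms, rotated]) (metis sets.sigma_algebra_axioms space_borel)
qed

section \<open>The representing measure and its integral\<close>

definition representing_measure :: "'a measure" where
  "representing_measure = measure_of UNIV (sets borel) outer"

lemma sets_representing_measure: "sets representing_measure = sets borel"
  unfolding representing_measure_def by (metis sets.sets_measure_of_eq space_borel)

lemma emeasure_representing_measure:
  assumes "A \<in> sets borel"
  shows "emeasure representing_measure A = outer A"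
  using measure_space_outer assms unfolding representing_measure_def measure_space_def
  by (intro emeasure_measure_of_sigma) auto

lemma prob_space_representing_measure: "prob_space representing_measure"
  using sets_eq_imp_space_eq[OF sets_representing_measure]
  by (intro prob_spaceI) (simp add: emeasure_representing_measure outer_UNIV)

lemma integrable_continuous:
  assumes "continuous_on UNIV f"
  shows "integrable representing_measure (f :: 'a \<Rightarrow> real)"
proof -
  interpret prob_space representing_measure by (rule prob_space_representing_measure)
  have "compact (f ` UNIV)" using assms compact_UNIV by (rule compact_continuous_image)
  then obtain B where "\<And>x. norm (f x) \<le> B"
    by (meson bounded_iff compact_imp_bounded rangeI)
  moreover have "f \<in> borel_measurable representing_measure"
    using borel_measurable_continuous_onI[OF assms]
    by (simp add: measurable_cong_sets[OF sets_representing_measure refl])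
  ultimately show ?thesis
    by (intro integrable_const_bound[where B = B]) auto
qed

(* Layer cake: f is the sum of its slices s i of height 1/n, and the i-th slice
   is at least 1/n on the set where the next one is nonzero. *)
lemma integral_le_unit_range:
  assumes f: "continuous_on UNIV f" "\<And>x. 0 \<le> f x" "\<And>x. f x \<le> 1"
  shows "(LINT x|representing_measure. f x) \<le> \<Lambda> f"
proof (rule field_le_epsilon)
  interpret prob_space representing_measure by (rule prob_space_representing_measure)
  fix e :: real assume "0 < e"
  then obtain m where m: "1 / real (Suc m) < e"
    using nat_approx_posE by metis
  define n where "n = Suc m"
  define s where "s i x = min (f x) ((i + 1) / n) - min (f x) (i / n)" for i :: nat and x
  define D where "D i = {x. real i / n \<le> f x}" for i :: nat
  have n: "real n > 0" by (simp add: n_def)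
  have sc: "continuous_on UNIV (s i)" for i
    unfolding s_def by (intro continuous_intros f)
  have s0: "0 \<le> s i x" for i x
  proof -
    have "real i / n \<le> (i + 1) / n" using n by (intro divide_right_mono) auto
    then show ?thesis by (auto simp: s_def)
  qed
  have "closed (D i)" for i
    unfolding D_def by (intro closed_Collect_le continuous_intros f)
  then have Dm: "D i \<in> sets representing_measure" for i
    by (auto simp: sets_representing_measure)
  have step: "(i + 1) / real n = i / n + 1 / n" for i :: real by (simp add: add_divide_distrib)
  have sD: "s i x \<le> (1 / n) * indicat_real (D i) x" for i x
    using n step[of "real i"] by (auto simp: s_def D_def indicator_def min_def add.commute[of 1])
  have sum_s: "(\<Sum>i<n. s i x) = f x" for x
  proof -
    have "(\<Sum>i<n. s i x) = (\<Sum>i<n. min (f x) (real (Suc i) / n) - min (f x) (real i / n))"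
      by (simp add: s_def add.commute)
    also have "\<dots> = min (f x) (real n / n) - min (f x) (real 0 / n)"
      by (rule sum_lessThan_telescope)
    also have "\<dots> = f x" using n f(2,3)[of x] by simp
    finally show ?thesis .
  qed
  have D_le: "(1 / n) * prob (D (Suc i)) \<le> \<Lambda> (s i)" for i
  proof -
    have "outer (D (Suc i)) \<le> ennreal (\<Lambda> (\<lambda>x. n * s i x))"
    proof (rule outer_le_single)
      fix x assume "x \<in> D (Suc i)"
      then have "(real i + 1) / n \<le> f x" by (simp add: D_def add.commute)
      moreover have "0 < 1 / real n" using n by simp
      ultimately have "s i x = 1 / n"
        using step[of "real i"] by (simp only: s_def of_nat_add of_nat_1)
      then show "1 \<le> n * s i x" using n by simp
    qed (use n in \<open>auto intro!: continuous_intros sc mult_nonneg_nonneg s0\<close>)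
    then have "ennreal (prob (D (Suc i))) \<le> ennreal (n * \<Lambda> (s i))"
      using Dm[of "Suc i"] unfolding sets_representing_measure
      by (simp add: emeasure_eq_measure[symmetric] emeasure_representing_measure scale sc)
    then have "prob (D (Suc i)) \<le> n * \<Lambda> (s i)"
      using n nonneg[OF sc s0, of i] by (simp add: ennreal_le_iff)
    then show ?thesis using n by (simp add: field_simps)
  qed
  have "(LINT x|representing_measure. f x) = (\<Sum>i<n. LINT x|representing_measure. s i x)"
    by (subst Bochner_Integration.integral_sum[symmetric])
       (auto simp: sum_s integrable_continuous sc)
  also have "\<dots> \<le> (\<Sum>i<n. LINT x|representing_measure. (1 / n) * indicat_real (D i) x)"
    using Dm by (intro sum_mono integral_mono[OF integrable_continuous[OF sc] _ sD])
      (auto simp: less_top[symmetric])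
  also have "\<dots> = (\<Sum>i<n. (1 / n) * prob (D i))"
    using Dm by simp
  \<comment> \<open>Slice i lies below its height on D i, while its functional dominates the height
    times the measure of D (i + 1). The index shift leaves the single term at D 0, of size at most
    1/n < e.\<close>
  also have "\<dots> = (1 / n) * prob (D 0) + (\<Sum>i<m. (1 / n) * prob (D (Suc i)))"
    by (simp only: n_def sum.lessThan_Suc_shift)
  also have "\<dots> \<le> (1 / n) * 1 + (\<Sum>i<m. \<Lambda> (s i))"
    using n by (intro add_mono sum_mono D_le mult_left_mono prob_le_1) auto
  also have "\<dots> \<le> 1 / n + (\<Sum>i<n. \<Lambda> (s i))"
    by (simp add: n_def nonneg[OF sc s0])
  also have "(\<Sum>i<n. \<Lambda> (s i)) = \<Lambda> f"
    by (subst sum[symmetric]) (auto simp: sum_s sc)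
  also have "1 / n + \<Lambda> f \<le> \<Lambda> f + e" using m by (simp add: n_def)
  finally show "(LINT x|representing_measure. f x) \<le> \<Lambda> f + e" .
qed

text \<open>The inequality for functions with values in [0, 1], applied to g and to 1 - g, gives
  equality for g since both sides send 1 to 1. A general f is an affine image of such a g.\<close>

theorem integral_representing_measure:
  assumes f: "continuous_on UNIV f"
  shows "(LINT x|representing_measure. f x) = \<Lambda> f"
proof -
  interpret prob_space representing_measure by (rule prob_space_representing_measure)
  have sp: "space representing_measure = UNIV"
    using sets_eq_imp_space_eq[OF sets_representing_measure] by simp
  have "compact (f ` UNIV)" using assms compact_UNIV by (rule compact_continuous_image)
  then obtain B where B: "\<And>x. \<bar>f x\<bar> \<le> B" "B > 0"
    by (metis UNIV_I bounded_pos compact_imp_bounded image_eqI real_norm_def)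
  define g where "g x = 1 / (2 * B) * f x + 1 / 2" for x
  have g: "0 \<le> g x" "g x \<le> 1" for x
    using B(1)[of x] B(2) by (auto simp: g_def field_simps abs_le_iff)
  have gc: "continuous_on UNIV g"
    unfolding g_def by (intro continuous_intros f)
  have "(LINT x|representing_measure. g x) \<le> \<Lambda> g"
    by (intro integral_le_unit_range g gc)
  moreover have "(LINT x|representing_measure. 1 - g x) \<le> \<Lambda> (\<lambda>x. 1 - g x)"
    by (intro integral_le_unit_range) (use g in \<open>auto intro!: continuous_intros gc\<close>)
  ultimately have "(LINT x|representing_measure. g x) = \<Lambda> g"
    using integrable_continuous[OF gc] by (simp add: diff gc one sp prob_space[unfolded sp])
  moreover have "\<Lambda> g = 1 / (2 * B) * \<Lambda> f + 1 / 2"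
    unfolding g_def using add[of "\<lambda>x. 1 / (2 * B) * f x" "\<lambda>_. 1 / 2"] f
    by (simp only: const scale continuous_on_const continuous_on_mult_left)
  moreover have "(LINT x|representing_measure. g x) = 1 / (2 * B) * (LINT x|representing_measure. f x) + 1 / 2"
    unfolding g_def using integrable_continuous[OF f] prob_space by simp
  ultimately show ?thesis using B(2) by simp
qed

end


text \<open>Closed sets form an intersection-stable generator of the Borel sets, and the indicator
  of a nonempty closed set is a bounded pointwise limit of continuous functions. This reduces
  invariance of a measure to test integrals.\<close>

lemma prob_measure_eqI_continuous:
  fixes M N :: "'a::metric_space measure"
  assumes sM: "sets M = sets borel" and sN: "sets N = sets borel"
    and pM: "prob_space M" and pN: "prob_space N"
    and eq: "\<And>f :: 'a \<Rightarrow> real. continuous_on UNIV f \<Longrightarrow> (LINT x|M. f x) = (LINT x|N. f x)"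
  shows "M = N"
proof (rule measure_eqI_generator_eq[where E = "Collect closed" and \<Omega> = UNIV and A = "\<lambda>_. UNIV"])
  interpret M: prob_space M by fact
  interpret N: prob_space N by fact
  fix C :: "'a set" assume "C \<in> Collect closed"
  then have C: "closed C" by simp
  define f where "f n x = max 0 (1 - real n * infdist x C)" for n x
  have fc: "continuous_on UNIV (f n)" for n
    unfolding f_def by (intro continuous_intros)
  have meas: "f n \<in> borel_measurable K" if "sets K = sets borel" for n K
    using borel_measurable_continuous_onI[OF fc] by (simp add: measurable_cong_sets[OF that refl])
  have f01: "norm (f n x) \<le> 1" for n x
    by (auto simp: f_def infdist_nonneg)
  have lim: "(\<lambda>n. f n x) \<longlonglongrightarrow> indicat_real C x" if "C \<noteq> {}" for x
  proof (cases "x \<in> C")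
    case True
    then show ?thesis by (simp add: f_def)
  next
    case False
    then have pos: "infdist x C > 0" using infdist_pos_not_in_closed[OF C that] by simp
    then obtain N :: nat where N: "1 < N * infdist x C"
      using reals_Archimedean3 by blast
    have "f n x = 0" if "n \<ge> N" for n
    proof -
      have "N * infdist x C \<le> n * infdist x C" using that pos by (intro mult_right_mono) auto
      then show ?thesis using N by (simp add: f_def)
    qed
    then have "eventually (\<lambda>n. f n x = indicat_real C x) sequentially"
      using False by (auto simp: eventually_sequentially)
    then show ?thesis by (rule tendsto_eventually)
  qed
  have conv: "(\<lambda>n. LINT x|K. f n x) \<longlonglongrightarrow> measure K C"
    if K: "sets K = sets borel" "prob_space K" "C \<noteq> {}" for K
  proof -
    interpret K: prob_space K by fact
    have "C \<in> sets K" using C K by simp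
    moreover have "(\<lambda>n. LINT x|K. f n x) \<longlonglongrightarrow> (LINT x|K. indicat_real C x)"
      by (rule integral_dominated_convergence[where w = "\<lambda>_. 1"])
         (use f01 lim K meas \<open>C \<in> sets K\<close> in auto)
    ultimately show ?thesis by simp
  qed
  show "emeasure M C = emeasure N C"
  \<comment> \<open>For empty C every f n is constantly 1, because \<open>infdist x {}\<close> is 0,
    so the limit argument is confined to nonempty C.\<close>
  proof (cases "C = {}")
    case False
    have "measure M C = measure N C"
      using LIMSEQ_unique[OF conv[OF sM pM False]] conv[OF sN pN False] by (simp add: eq fc)
    then show ?thesis by (simp add: M.emeasure_eq_measure N.emeasure_eq_measure)
  qed simp
next
  interpret M: prob_space M by fact
  show "emeasure M UNIV \<noteq> \<infinity>" for i :: nat by simp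
qed (use sM sN in \<open>auto simp: Int_stable_def borel_eq_closed\<close>)

subsection \<open>Cover sums of average pseudo-orbits\<close>

definition empirical :: "nat \<Rightarrow> (nat \<Rightarrow> 'a) \<Rightarrow> ('a \<Rightarrow> real) \<Rightarrow> real" where
  "empirical n x g = (\<Sum>i<n. g (x i)) / real n"

text \<open>The analogue of \<open>avg_pseudo_orbits_near\<close> that can be stated before a
  measure exists; \<open>avg_pseudo_orbits_near_eq\<close> identifies the two once \<Lambda> is
  integration on L.\<close>

definition pseudo_orbits_near_functional ::
    "('a::metric_space \<Rightarrow> 'a) \<Rightarrow> nat \<Rightarrow> real \<Rightarrow> (('a \<Rightarrow> real) \<Rightarrow> real) \<Rightarrow> ('a \<Rightarrow> real) set
     \<Rightarrow> (nat \<Rightarrow> 'a) set" where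
  "pseudo_orbits_near_functional T n \<delta> \<Lambda> L =
     {x \<in> avg_pseudo_orbits T n \<delta>. \<forall>g\<in>L. \<bar>empirical n x g - \<Lambda> g\<bar> \<le> \<delta>}"

section \<open>Closedness and measurability of the pseudo-orbit sets\<close>

lemma topspace_pow_top: "topspace (pow_top n) = PiE {..<n} (\<lambda>_. UNIV)"
  by (simp add: pow_top_def)

lemma continuous_map_pow_top_coordinate:
  assumes "i < n" "continuous_on UNIV g"
  shows "continuous_map (pow_top n) euclidean (\<lambda>x. g (x i))"
proof -
  have "continuous_map (pow_top n) euclidean (\<lambda>x. x i)"
    unfolding pow_top_def by (rule continuous_map_product_projection) (use assms in auto)
  moreover have "continuous_map euclidean euclidean g"
    using assms by simp
  ultimately have "continuous_map (pow_top n) euclidean (g \<circ> (\<lambda>x. x i))"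
    by (rule continuous_map_compose)
  then show ?thesis by (simp add: comp_def)
qed

lemma continuous_map_dist_coordinates:
  assumes "i < n" "j < n" "continuous_on UNIV T"
  shows "continuous_map (pow_top n) euclideanreal (\<lambda>x. dist (T (x i)) (x j))"
proof -
  have "continuous_map (pow_top n) (prod_topology euclidean euclidean) (\<lambda>x. (T (x i), x j))"
    using continuous_map_pow_top_coordinate[of i n T] continuous_map_pow_top_coordinate[of j n "\<lambda>x. x"] assms
    by (intro continuous_map_pairedI) (auto simp: comp_def)
  moreover have "continuous_map (prod_topology euclidean euclidean) euclideanreal (\<lambda>p. dist (fst p) (snd p))"
    by (simp add: euclidean_product_topology[symmetric] continuous_intros)
  ultimately have "continuous_map (pow_top n) euclideanreal ((\<lambda>p. dist (fst p) (snd p)) \<circ> (\<lambda>x. (T (x i), x j)))"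
    by (rule continuous_map_compose)
  then show ?thesis by (simp add: comp_def)
qed

lemma closedin_sublevel:
  assumes "continuous_map X euclideanreal f"
  shows "closedin X {x \<in> topspace X. f x \<le> c}"
  using closedin_continuous_map_preimage[OF assms, of "{..c}"] by simp

lemma closedin_avg_pseudo_orbits:
  assumes "continuous_on UNIV T"
  shows "closedin (pow_top n) (avg_pseudo_orbits T n \<delta>)"
proof -
  have "continuous_map (pow_top n) euclideanreal (\<lambda>x. \<Sum>i<n - 1. dist (T (x i)) (x (Suc i)))"
    by (rule continuous_map_sum) (auto intro: continuous_map_dist_coordinates[OF _ _ assms])
  then have "continuous_map (pow_top n) euclideanreal
      (\<lambda>x. (\<Sum>i<n - 1. dist (T (x i)) (x (Suc i))) / real (n - 1))"
    unfolding divide_inverse by (rule continuous_map_real_mult) simp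
  then show ?thesis
    unfolding avg_pseudo_orbits_def by (rule closedin_sublevel)
qed

lemma borel_sets_closedin: "closedin Z S \<Longrightarrow> S \<in> borel_sets Z"
  unfolding borel_sets_def closedin_def
  by (metis (no_types, lifting) double_diff mem_Collect_eq order_refl sigma_sets.Basic sigma_sets.Compl)

lemma borel_sets_Int: "A \<in> borel_sets Z \<Longrightarrow> B \<in> borel_sets Z \<Longrightarrow> A \<inter> B \<in> borel_sets Z"
proof -
  interpret sigma_algebra "topspace Z" "borel_sets Z"
    unfolding borel_sets_def by (rule sigma_algebra_sigma_sets) (auto dest: openin_subset)
  show "A \<in> borel_sets Z \<Longrightarrow> B \<in> borel_sets Z \<Longrightarrow> A \<inter> B \<in> borel_sets Z" by auto
qed

text \<open>Subadditivity of cover sums asks for Borel pieces. This one is an intersection of closed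
  conditions on finitely many coordinates.\<close>

lemma borel_sets_pseudo_orbits_near_functional:
  assumes T: "continuous_on UNIV T" and L: "finite L" "\<And>g. g \<in> L \<Longrightarrow> continuous_on UNIV g"
  shows "pseudo_orbits_near_functional T n \<delta> \<Lambda> L \<in> borel_sets (pow_top n)"
proof (rule borel_sets_closedin)
  let ?A = "\<lambda>g. {x \<in> topspace (pow_top n). \<bar>empirical n x g - \<Lambda> g\<bar> \<le> \<delta>}"
  have "closedin (pow_top n) (?A g)" if "g \<in> L" for g
    unfolding empirical_def divide_inverse
    by (intro closedin_sublevel continuous_map_real_abs continuous_map_diff continuous_map_real_mult
        continuous_map_sum continuous_map_pow_top_coordinate[OF _ L(2)[OF that]]) auto
  then have "closedin (pow_top n) (\<Inter>(insert (avg_pseudo_orbits T n \<delta>) (?A ` L)))"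
    using closedin_avg_pseudo_orbits[OF T] by (intro closedin_Inter) auto
  moreover have "pseudo_orbits_near_functional T n \<delta> \<Lambda> L = \<Inter>(insert (avg_pseudo_orbits T n \<delta>) (?A ` L))"
    by (auto simp: pseudo_orbits_near_functional_def avg_pseudo_orbits_def)
  ultimately show "closedin (pow_top n) (pseudo_orbits_near_functional T n \<delta> \<Lambda> L)" by simp
qed

section \<open>Monotonicity and finite subadditivity of cover sums\<close>

lemma cover_sum_le:
  assumes "is_cover (pow_top n) K \<V>" "finer_cover \<V> (cover_pow \<U> n)"
  shows "cover_sum F \<U> n K \<le> (\<Sum>V\<in>\<V>. SUP x\<in>V. ennreal (exp (F n x)))"
  unfolding cover_sum_def using assms by (intro Inf_lower) auto

lemma cover_sum_empty: "cover_sum F \<U> n {} = 0"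
  using cover_sum_le[of n "{}" "{}"] by (simp add: is_cover_def finer_cover_def)

lemma cover_sum_mono:
  assumes "K \<subseteq> K'"
  shows "cover_sum F \<U> n K \<le> cover_sum F \<U> n K'"
  unfolding cover_sum_def[of _ _ _ K']
proof (rule Inf_greatest, clarify)
  fix \<V> assume V: "is_cover (pow_top n) K' \<V>" "finer_cover \<V> (cover_pow \<U> n)"
  let ?W = "(\<lambda>V. V \<inter> K) ` \<V>"
  let ?s = "\<lambda>V. SUP x\<in>V. ennreal (exp (F n x))"
  have "is_cover (pow_top n) K ?W"
    unfolding is_cover_def
  proof (intro conjI ballI)
    show "finite ?W" "\<Union>?W = K" using V(1) assms by (auto simp: is_cover_def)
    fix U assume "U \<in> ?W"
    then obtain V where U: "V \<in> \<V>" "U = V \<inter> K" by blast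
    then obtain B where "B \<in> borel_sets (pow_top n)" "V = B \<inter> K'"
      using V(1) unfolding is_cover_def by blast
    then show "\<exists>B\<in>borel_sets (pow_top n). U = B \<inter> K" using assms U by blast
  qed
  moreover have "finer_cover ?W (cover_pow \<U> n)"
    unfolding finer_cover_def
  proof
    fix U assume "U \<in> ?W"
    then obtain V where "V \<in> \<V>" "U \<subseteq> V" by blast
    then show "\<exists>W\<in>cover_pow \<U> n. U \<subseteq> W" using V(2) unfolding finer_cover_def by (meson order_trans)
  qed
  ultimately have "cover_sum F \<U> n K \<le> (\<Sum>V\<in>?W. ?s V)"
    by (rule cover_sum_le)
  \<comment> \<open>Different V may have the same trace on K, and merging them can only decrease the
    sum.\<close>
  also have "\<dots> \<le> (\<Sum>V\<in>\<V>. ?s (V \<inter> K))"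
    using V(1) sum_image_le[of \<V> ?s "\<lambda>V. V \<inter> K"] by (auto simp: is_cover_def comp_def)
  also have "\<dots> \<le> (\<Sum>V\<in>\<V>. ?s V)"
    by (intro sum_mono SUP_subset_mono) auto
  finally show "cover_sum F \<U> n K \<le> (\<Sum>V\<in>\<V>. ?s V)" .
qed

text \<open>Near-optimal covers of K and K' are united. Their members are Borel only relative to K
  or K', and measurability of K and K' themselves makes them Borel relative to the union.\<close>

lemma cover_sum_Un:
  assumes K: "K \<in> borel_sets (pow_top n)" "K' \<in> borel_sets (pow_top n)"
  shows "cover_sum F \<U> n (K \<union> K') \<le> cover_sum F \<U> n K + cover_sum F \<U> n K'"
proof (rule ennreal_le_epsilon)
  fix e :: real assume fin: "cover_sum F \<U> n K + cover_sum F \<U> n K' < top" and e: "0 < e"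
  let ?s = "\<lambda>V. SUP x\<in>V. ennreal (exp (F n x))"
  have ex: "\<exists>\<V>. is_cover (pow_top n) H \<V> \<and> finer_cover \<V> (cover_pow \<U> n) \<and>
      (\<Sum>V\<in>\<V>. ?s V) < cover_sum F \<U> n H + ennreal (e / 2)" if "cover_sum F \<U> n H < top" for H
  proof -
    have "cover_sum F \<U> n H < cover_sum F \<U> n H + ennreal (e / 2)"
      using that e by (auto simp: less_top)
    then show ?thesis unfolding cover_sum_def[of _ _ _ H] Inf_less_iff by blast
  qed
  obtain \<V> where V: "is_cover (pow_top n) K \<V>" "finer_cover \<V> (cover_pow \<U> n)"
      "(\<Sum>V\<in>\<V>. ?s V) < cover_sum F \<U> n K + ennreal (e / 2)"
    using ex[of K] fin by (auto simp: less_top)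
  obtain \<W> where W: "is_cover (pow_top n) K' \<W>" "finer_cover \<W> (cover_pow \<U> n)"
      "(\<Sum>V\<in>\<W>. ?s V) < cover_sum F \<U> n K' + ennreal (e / 2)"
    using ex[of K'] fin by (auto simp: less_top)
  have rel: "\<exists>B\<in>borel_sets (pow_top n). V = B \<inter> (K \<union> K')"
    if "is_cover (pow_top n) H \<X>" "V \<in> \<X>" "H \<in> borel_sets (pow_top n)" "H \<subseteq> K \<union> K'" for V \<X> H
  proof -
    obtain B where "B \<in> borel_sets (pow_top n)" "V = B \<inter> H"
      using \<open>is_cover (pow_top n) H \<X>\<close> \<open>V \<in> \<X>\<close> unfolding is_cover_def by blast
    then have "B \<inter> H \<in> borel_sets (pow_top n)" "V = (B \<inter> H) \<inter> (K \<union> K')"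
      using borel_sets_Int that by auto
    then show ?thesis by blast
  qed
  have "is_cover (pow_top n) (K \<union> K') (\<V> \<union> \<W>)"
    using rel[OF V(1)] rel[OF W(1)] K V(1) W(1) unfolding is_cover_def[of _ "K \<union> K'"]
    by (auto simp: is_cover_def)
  moreover have "finer_cover (\<V> \<union> \<W>) (cover_pow \<U> n)"
    using V(2) W(2) by (auto simp: finer_cover_def)
  ultimately have "cover_sum F \<U> n (K \<union> K') \<le> (\<Sum>V\<in>\<V> \<union> \<W>. ?s V)"
    by (rule cover_sum_le)
  also have "\<dots> \<le> (\<Sum>V\<in>\<V>. ?s V) + (\<Sum>V\<in>\<W>. ?s V)"
    using V(1) W(1) by (subst sum.union_inter[symmetric]) (auto simp: is_cover_def)
  also have "\<dots> \<le> (cover_sum F \<U> n K + ennreal (e / 2)) + (cover_sum F \<U> n K' + ennreal (e / 2))"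
    using V(3) W(3) by (intro add_mono less_imp_le)
  also have "\<dots> = cover_sum F \<U> n K + cover_sum F \<U> n K' + ennreal e"
  proof -
    have "ennreal e = ennreal (e / 2) + ennreal (e / 2)" using e by (simp flip: ennreal_plus)
    then show ?thesis by (simp add: ac_simps)
  qed
  finally show "cover_sum F \<U> n (K \<union> K') \<le> cover_sum F \<U> n K + cover_sum F \<U> n K' + ennreal e" .
qed

lemma cover_sum_UN:
  assumes "finite I" "\<And>i. i \<in> I \<Longrightarrow> K i \<in> borel_sets (pow_top n)"
  shows "cover_sum F \<U> n (\<Union>i\<in>I. K i) \<le> (\<Sum>i\<in>I. cover_sum F \<U> n (K i))"
proof -
  interpret sigma_algebra "topspace (pow_top n)" "borel_sets (pow_top n)"
    unfolding borel_sets_def by (rule sigma_algebra_sigma_sets) (auto dest: openin_subset)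
  show ?thesis
    using assms
  proof (induction I)
    case (insert i I)
    have "cover_sum F \<U> n (K i \<union> (\<Union>i\<in>I. K i)) \<le> cover_sum F \<U> n (K i) + cover_sum F \<U> n (\<Union>i\<in>I. K i)"
      using insert by (intro cover_sum_Un finite_UN) auto
    also have "\<dots> \<le> cover_sum F \<U> n (K i) + (\<Sum>i\<in>I. cover_sum F \<U> n (K i))"
      using insert by (intro add_left_mono) auto
    finally show ?case using insert by simp
  qed (simp add: cover_sum_empty)
qed

section \<open>Exponential growth rates of cover sums\<close>

lemma elog_less_imp_le_exp:
  assumes "elog a / ereal (real n) < ereal r" "n > 0"
  shows "a \<le> ennreal (exp (r * real n))"
proof (cases a rule: ennreal_cases)
  case (real b)
  show ?thesis
  proof (cases "b = 0")
    case False
    then have "ln b < r * real n"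
      using assms real by (simp add: elog_def field_simps)
    then have "exp (ln b) < exp (r * real n)" by simp
    then have "b \<le> exp (r * real n)" using real False by simp
    then show ?thesis using real by (simp add: ennreal_leI)
  qed (simp add: real)
qed (use assms in \<open>simp add: elog_def\<close>)

text \<open>The prefactor N, later the number of pieces of a union, contributes ln N / n to the rate
  and disappears in the limit.\<close>

lemma elog_le:
  assumes "a \<le> ennreal (N * exp (r * real n))" "n > 0" "N > 0"
  shows "elog a / ereal (real n) \<le> ereal (ln N / real n + r)"
proof (cases a rule: ennreal_cases)
  case (real b)
  show ?thesis
  proof (cases "b = 0")
    case True
    then show ?thesis using real assms by (simp add: elog_def)
  next
    case False
    then have "b \<le> N * exp (r * real n)" using real assms by (simp add: ennreal_le_iff)
    then have "ln b \<le> ln (N * exp (r * real n))" using False real by (subst ln_le_cancel_iff) (use assms in auto)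
    also have "\<dots> = ln N + r * real n" using assms by (simp add: ln_mult)
    finally show ?thesis
      using assms real False by (simp add: elog_def field_simps)
  qed
qed (use assms in \<open>simp add: top_unique\<close>)

text \<open>The rate of a finite union is governed by the largest rate among its pieces. Finiteness
  keeps the inequality strict: some real r fits between the maximum and c.\<close>

lemma limsup_cover_sum_finite_union_less:
  assumes I: "finite I" "I \<noteq> {}"
    and B: "\<And>i n. i \<in> I \<Longrightarrow> K i n \<in> borel_sets (pow_top n)"
    and sub: "\<And>n. n > 0 \<Longrightarrow> H n \<subseteq> (\<Union>i\<in>I. K i n)"
    and lt: "\<And>i. i \<in> I \<Longrightarrow> limsup (\<lambda>n. elog (cover_sum F \<U> n (K i n)) / ereal (real n)) < c"
  shows "limsup (\<lambda>n. elog (cover_sum F \<U> n (H n)) / ereal (real n)) < c"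
proof -
  let ?l = "\<lambda>i. limsup (\<lambda>n. elog (cover_sum F \<U> n (K i n)) / ereal (real n))"
  have "Max (?l ` I) < c" using I lt by (subst Max_less_iff) auto
  then obtain r where r: "Max (?l ` I) < ereal r" "ereal r < c" using ereal_dense2 by blast
  have "\<forall>i\<in>I. eventually (\<lambda>n. elog (cover_sum F \<U> n (K i n)) / ereal (real n) < ereal r) sequentially"
  proof
    fix i assume "i \<in> I"
    then have "?l i < ereal r" using I r(1) by (subst (asm) Max_less_iff) auto
    then show "eventually (\<lambda>n. elog (cover_sum F \<U> n (K i n)) / ereal (real n) < ereal r) sequentially"
      by (rule Limsup_lessD)
  qed
  then have "eventually (\<lambda>n. \<forall>i\<in>I. elog (cover_sum F \<U> n (K i n)) / ereal (real n) < ereal r) sequentially"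
    using I by (simp add: eventually_ball_finite)
  then have ev: "eventually (\<lambda>n. elog (cover_sum F \<U> n (H n)) / ereal (real n) \<le> ereal (ln (card I) / real n + r)) sequentially"
    using eventually_gt_at_top[of "0::nat"]
  proof eventually_elim
    case (elim n)
    have "cover_sum F \<U> n (H n) \<le> cover_sum F \<U> n (\<Union>i\<in>I. K i n)"
      using elim sub by (intro cover_sum_mono) auto
    also have "\<dots> \<le> (\<Sum>i\<in>I. cover_sum F \<U> n (K i n))"
      using I B by (intro cover_sum_UN) auto
    also have "\<dots> \<le> (\<Sum>i\<in>I. ennreal (exp (r * real n)))"
      using elim by (intro sum_mono elog_less_imp_le_exp) auto
    also have "\<dots> = ennreal (card I * exp (r * real n))"
      by (simp add: ennreal_mult ennreal_of_nat_eq_real_of_nat)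
    finally show ?case using elim I by (intro elog_le) (auto simp: card_gt_0_iff)
  qed
  have "(\<lambda>n. ln (card I) / real n + r) \<longlonglongrightarrow> 0 + r"
    by (intro tendsto_intros lim_const_over_n)
  then have "limsup (\<lambda>n. ereal (ln (card I) / real n + r)) = ereal r"
    by (intro lim_imp_Limsup) auto
  then have "limsup (\<lambda>n. elog (cover_sum F \<U> n (H n)) / ereal (real n)) \<le> ereal r"
    using Limsup_mono[OF ev] by simp
  then show ?thesis using r(2) by simp
qed

lemma avg_pseudo_orbits_mono: "\<delta> \<le> \<delta>' \<Longrightarrow> avg_pseudo_orbits T n \<delta> \<subseteq> avg_pseudo_orbits T n \<delta>'"
  by (auto simp: avg_pseudo_orbits_def)

text \<open>A genuine orbit has no jumps at all; \<open>undefined\<close> serves as an arbitrary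
  starting point.\<close>

lemma avg_pseudo_orbits_nonempty:
  assumes "\<delta> \<ge> 0"
  shows "avg_pseudo_orbits T n \<delta> \<noteq> {}"
proof -
  have "(\<Sum>i<n - 1. dist (T ((T ^^ i) undefined)) ((T ^^ Suc i) undefined)) = 0" by simp
  moreover have "(\<Sum>i<n - 1. dist (T (restrict (\<lambda>i. (T ^^ i) undefined) {..<n} i)) (restrict (\<lambda>i. (T ^^ i) undefined) {..<n} (Suc i)))
    = (\<Sum>i<n - 1. dist (T ((T ^^ i) undefined)) ((T ^^ Suc i) undefined))"
    by (intro sum.cong) auto
  ultimately have "restrict (\<lambda>i. (T ^^ i) undefined) {..<n} \<in> avg_pseudo_orbits T n \<delta>"
    using assms unfolding avg_pseudo_orbits_def by (simp add: topspace_pow_top)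
  then show ?thesis by blast
qed

subsection \<open>Limit functionals of empirical averages\<close>

(* Compactness of the space of empirical functionals in the product topology (Tychonoff)
   replaces weak-* compactness of the space of measures. *)
lemma exists_functional:
  fixes T :: "'a::metric_space \<Rightarrow> 'a"
  assumes "tds T"
  obtains \<Lambda> :: "('a \<Rightarrow> real) \<Rightarrow> real" where
    "\<And>L \<delta>. finite L \<Longrightarrow> (\<forall>g\<in>L. continuous_on UNIV g) \<Longrightarrow> \<delta> > 0 \<Longrightarrow>
       GP T F \<U> \<le> limsup (\<lambda>n. elog (cover_sum F \<U> n (pseudo_orbits_near_functional T n \<delta> \<Lambda> L)) / ereal (real n))"
    "\<And>L \<delta>. finite L \<Longrightarrow> (\<forall>g\<in>L. continuous_on UNIV g) \<Longrightarrow> \<delta> > 0 \<Longrightarrow>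
       \<exists>\<^sub>F n in sequentially. pseudo_orbits_near_functional T n \<delta> \<Lambda> L \<noteq> {}"
proof -
  have cpt: "compact (UNIV :: 'a set)" and T: "continuous_on UNIV T"
    using assms by (auto simp: tds_def)
  have "\<exists>B. \<forall>x. \<bar>g x\<bar> \<le> B" if "continuous_on UNIV g" for g :: "'a \<Rightarrow> real"
    using compact_imp_bounded[OF compact_continuous_image[OF that cpt]] by (auto simp: bounded_iff)
  then obtain B where B: "\<And>(g :: 'a \<Rightarrow> real) x. continuous_on UNIV g \<Longrightarrow> \<bar>g x\<bar> \<le> B g" by metis
  \<comment> \<open>Discontinuous functions come with no bound on their averages, so their factor is
    {0}; the empirical functionals are modified accordingly below.\<close>
  define S where "S = (PiE UNIV (\<lambda>g. if continuous_on UNIV g then {-B g..B g} else {0}))"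
  have "compact S"
  proof -
    have "compactin (product_topology (\<lambda>_. euclideanreal) (UNIV :: ('a \<Rightarrow> real) set)) S"
      unfolding S_def by (subst compactin_PiE) auto
    then show ?thesis by (simp add: euclidean_product_topology)
  qed
  let ?K = "pseudo_orbits_near_functional T"
  let ?lim = "\<lambda>\<delta> \<Lambda> L. limsup (\<lambda>n. elog (cover_sum F \<U> n (?K n \<delta> \<Lambda> L)) / ereal (real n))"
  define bad where "bad \<Lambda> L \<delta> \<longleftrightarrow> finite L \<and> (\<forall>g\<in>L. continuous_on UNIV g) \<and> \<delta> > 0 \<and>
      (?lim \<delta> \<Lambda> L < GP T F \<U> \<or> eventually (\<lambda>n. ?K n \<delta> \<Lambda> L = {}) sequentially)" for \<Lambda> L \<delta>
  have "\<exists>\<Lambda>\<in>S. \<forall>L \<delta>. \<not> bad \<Lambda> L \<delta>"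
  proof (rule ccontr)
    assume "\<not> ?thesis"
    then obtain L \<delta> where bad: "\<And>\<Lambda>. \<Lambda> \<in> S \<Longrightarrow> bad \<Lambda> (L \<Lambda>) (\<delta> \<Lambda>)" by metis
    \<comment> \<open>Finiteness of L \<Lambda> and the strict inequality make this a basic open set
      of the product topology. Membership of its points in \<open>?K\<close> needs only the weak
      inequality.\<close>
    define W where "W \<Lambda> = (\<Inter>g\<in>L \<Lambda>. {\<Lambda>' :: ('a \<Rightarrow> real) \<Rightarrow> real. \<bar>\<Lambda>' g - \<Lambda> g\<bar> < \<delta> \<Lambda>})" for \<Lambda>
    have op: "open (W \<Lambda>)" if "\<Lambda> \<in> S" for \<Lambda>
      unfolding W_def using bad[OF that]
      by (intro open_INT ballI open_Collect_less continuous_intros) (auto simp: bad_def)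
    have self: "\<Lambda> \<in> W \<Lambda>" if "\<Lambda> \<in> S" for \<Lambda>
      using bad[OF that] by (auto simp: W_def bad_def)
    obtain C where C: "C \<subseteq> S" "finite C" "S \<subseteq> (\<Union>\<Lambda>\<in>C. W \<Lambda>)"
      by (rule compactE_image[OF \<open>compact S\<close>, of S W]) (use op self in auto)
    have emp: "(\<lambda>g. if continuous_on UNIV g then empirical n x g else 0) \<in> S" if "n > 0" for n x
    proof -
      have "\<bar>empirical n x g\<bar> \<le> B g" if g: "continuous_on UNIV g" for g
      proof -
        have "\<bar>\<Sum>i<n. g (x i)\<bar> \<le> (\<Sum>i<n. B g)"
          using B[OF g] by (intro order.trans[OF sum_abs] sum_mono) auto
        then show ?thesis using \<open>n > 0\<close> by (simp add: empirical_def field_simps)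
      qed
      then show ?thesis by (auto simp: S_def abs_le_iff minus_le_iff)
    qed
    then have "S \<noteq> {}" using zero_less_one by blast
    then have "C \<noteq> {}" using C by auto
    \<comment> \<open>A single tolerance has to serve all pieces of the finite cover, hence the
      minimum.\<close>
    define d where "d = Min (\<delta> ` C)"
    have d: "d > 0" "\<And>\<Lambda>. \<Lambda> \<in> C \<Longrightarrow> d \<le> \<delta> \<Lambda>"
      using C \<open>C \<noteq> {}\<close> bad by (auto simp: d_def bad_def subset_iff)
    have cov: "avg_pseudo_orbits T n d \<subseteq> (\<Union>\<Lambda>\<in>C. ?K n (\<delta> \<Lambda>) \<Lambda> (L \<Lambda>))" if "n > 0" for n
    proof (rule subsetI)
      fix x assume x: "x \<in> avg_pseudo_orbits T n d"
      obtain \<Lambda> where \<Lambda>: "\<Lambda> \<in> C" "(\<lambda>g. if continuous_on UNIV g then empirical n x g else 0) \<in> W \<Lambda>"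
        using emp[OF \<open>n > 0\<close>, of x] C by blast
      have "x \<in> avg_pseudo_orbits T n (\<delta> \<Lambda>)"
        using avg_pseudo_orbits_mono[OF d(2)[OF \<Lambda>(1)]] x by blast
      moreover have "\<forall>g\<in>L \<Lambda>. continuous_on UNIV g"
        using bad \<Lambda>(1) C(1) unfolding bad_def by blast
      ultimately have "x \<in> ?K n (\<delta> \<Lambda>) \<Lambda> (L \<Lambda>)"
        using \<Lambda>(2) by (auto simp: pseudo_orbits_near_functional_def W_def intro: less_imp_le)
      then show "x \<in> (\<Union>\<Lambda>\<in>C. ?K n (\<delta> \<Lambda>) \<Lambda> (L \<Lambda>))" using \<Lambda>(1) by blast
    qed
    show False
    \<comment> \<open>If GP is -\<infinity>, only the emptiness alternative of \<open>bad\<close>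
      can hold, and it contradicts the existence of genuine orbits. Otherwise eventually empty
      pieces have rate -\<infinity> < GP, so both alternatives give a strictly smaller rate.\<close>
    proof (cases "GP T F \<U> = -\<infinity>")
      case True
      then have "\<forall>\<Lambda>\<in>C. eventually (\<lambda>n. ?K n (\<delta> \<Lambda>) \<Lambda> (L \<Lambda>) = {}) sequentially"
        using bad C(1) unfolding bad_def by fastforce
      then have "eventually (\<lambda>n. \<forall>\<Lambda>\<in>C. ?K n (\<delta> \<Lambda>) \<Lambda> (L \<Lambda>) = {}) sequentially"
        using C(2) by (simp add: eventually_ball_finite)
      then have "eventually (\<lambda>n. False) sequentially"
        using eventually_gt_at_top[of "0::nat"]
      proof eventually_elim
        case (elim n)
        then show ?case using cov[of n] avg_pseudo_orbits_nonempty[of d T n] d(1) by auto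
      qed
      then show False by simp
    next
      case False
      have lt: "?lim (\<delta> \<Lambda>) \<Lambda> (L \<Lambda>) < GP T F \<U>" if "\<Lambda> \<in> C" for \<Lambda>
      proof -
        have "?lim (\<delta> \<Lambda>) \<Lambda> (L \<Lambda>) < GP T F \<U>" if ev: "eventually (\<lambda>n. ?K n (\<delta> \<Lambda>) \<Lambda> (L \<Lambda>) = {}) sequentially"
        proof -
          have "eventually (\<lambda>n. elog (cover_sum F \<U> n (?K n (\<delta> \<Lambda>) \<Lambda> (L \<Lambda>))) / ereal (real n) = -\<infinity>) sequentially"
            using ev eventually_gt_at_top[of "0::nat"]
            by eventually_elim (simp add: cover_sum_empty elog_def)
          then have "?lim (\<delta> \<Lambda>) \<Lambda> (L \<Lambda>) = limsup (\<lambda>n. -\<infinity>)"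
            by (rule Limsup_eq)
          then show ?thesis using False by (simp add: Limsup_const)
        qed
        then show ?thesis using bad that C(1) unfolding bad_def by blast
      qed
      have "GP_at T F \<U> d < GP T F \<U>"
        unfolding GP_at_def
      proof (rule limsup_cover_sum_finite_union_less[OF C(2) \<open>C \<noteq> {}\<close> _ cov lt])
        fix \<Lambda> n assume "\<Lambda> \<in> C"
        then show "?K n (\<delta> \<Lambda>) \<Lambda> (L \<Lambda>) \<in> borel_sets (pow_top n)"
          using bad C(1) unfolding bad_def
          by (intro borel_sets_pseudo_orbits_near_functional T) blast+
      qed
      moreover have "GP T F \<U> \<le> GP_at T F \<U> d"
        unfolding GP_def using d(1) by (intro INF_lower) auto
      ultimately show False by simp
    qed
  qed
  then obtain \<Lambda> where nb: "\<And>L \<delta>. \<not> bad \<Lambda> L \<delta>" by blast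
  have "GP T F \<U> \<le> ?lim \<delta> \<Lambda> L \<and> (\<exists>\<^sub>F n in sequentially. ?K n \<delta> \<Lambda> L \<noteq> {})"
    if "finite L" "\<forall>g\<in>L. continuous_on UNIV g" "\<delta> > 0" for L \<delta>
    using nb[of L \<delta>] that by (simp add: bad_def not_less frequently_def)
  then show thesis by (intro that[of \<Lambda>]) blast+
qed

text \<open>An affine form of uniform continuity that survives averaging: pairs closer than the
  modulus d cost at most e, and for all others the oscillation 2 B is at most (2 B / d) times the
  distance.\<close>

lemma continuous_le_dist:
  fixes g :: "'a::metric_space \<Rightarrow> real"
  assumes "compact (UNIV :: 'a set)" "continuous_on UNIV g" "e > 0"
  obtains C where "C \<ge> 0" "\<And>a b. \<bar>g a - g b\<bar> \<le> e + C * dist a b"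
proof -
  have "uniformly_continuous_on UNIV g"
    by (rule compact_uniformly_continuous[OF assms(2,1)])
  then obtain d where d: "d > 0" "\<And>a b. dist a b < d \<Longrightarrow> dist (g a) (g b) < e"
    using \<open>e > 0\<close> unfolding uniformly_continuous_on_def by (metis UNIV_I dist_commute)
  have "bounded (range g)"
    by (rule compact_imp_bounded[OF compact_continuous_image[OF assms(2,1)]])
  then obtain B where B: "\<And>x. \<bar>g x\<bar> \<le> B" by (auto simp: bounded_iff)
  have B0: "B \<ge> 0" using B[of undefined] by simp
  show thesis
  proof (rule that[of "2 * B / d"])
    fix a b
    show "\<bar>g a - g b\<bar> \<le> e + 2 * B / d * dist a b"
    proof (cases "dist a b < d")
      case True
      then have "\<bar>g a - g b\<bar> < e" using d(2) by (simp add: dist_real_def)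
      moreover have "0 \<le> 2 * B / d * dist a b" using B0 d(1) by auto
      ultimately show ?thesis by linarith
    next
      case False
      have "\<bar>g a - g b\<bar> \<le> 2 * B" using B[of a] B[of b] by linarith
      also have "\<dots> = 2 * B / d * d" using d by simp
      also have "\<dots> \<le> 2 * B / d * dist a b" using False B0 d(1) by (intro mult_left_mono) auto
      finally show ?thesis using assms(3) by linarith
    qed
  qed (use B0 d(1) in auto)
qed

text \<open>T x_i is compared with x_(i+1), not with x_i. The shift leaves two boundary values,
  bounded by 2 B, and the remaining differences are controlled by the jumps.\<close>

lemma empirical_compose_diff:
  assumes x: "x \<in> avg_pseudo_orbits T (Suc m) \<delta>" and m: "m > 0" and "C \<ge> 0" "e \<ge> 0"
    and g: "\<And>a b. \<bar>g a - g b\<bar> \<le> e + C * dist a b" and B: "\<And>a. \<bar>g a\<bar> \<le> B"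
  shows "\<bar>empirical (Suc m) x (\<lambda>y. g (T y)) - empirical (Suc m) x g\<bar> \<le> e + C * \<delta> + 2 * B / real (Suc m)"
proof -
  let ?D = "\<Sum>i<m. dist (T (x i)) (x (Suc i))"
  have D: "?D \<le> \<delta> * m"
    using x m by (simp add: avg_pseudo_orbits_def field_simps)
  have "0 \<le> ?D" by (intro sum_nonneg) auto
  then have "\<delta> * m \<ge> 0" using D by linarith
  then have \<delta>: "\<delta> \<ge> 0" using m by (simp add: zero_le_mult_iff)
  have "(\<Sum>i<Suc m. g (T (x i))) - (\<Sum>i<Suc m. g (x i))
      = (\<Sum>i<m. g (T (x i)) - g (x (Suc i))) + (g (T (x m)) - g (x 0))"
    by (simp only: sum.lessThan_Suc_shift[of "\<lambda>i. g (x i)"] sum.lessThan_Suc[of "\<lambda>i. g (T (x i))"] sum_subtractf)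
  also have "\<bar>\<dots>\<bar> \<le> \<bar>\<Sum>i<m. g (T (x i)) - g (x (Suc i))\<bar> + 2 * B"
    using B[of "T (x m)"] B[of "x 0"] by linarith
  also have "\<bar>\<Sum>i<m. g (T (x i)) - g (x (Suc i))\<bar> \<le> (\<Sum>i<m. e + C * dist (T (x i)) (x (Suc i)))"
    by (intro order.trans[OF sum_abs] sum_mono g)
  also have "\<dots> = e * m + C * ?D"
    by (simp add: sum.distrib sum_distrib_left)
  also have "\<dots> \<le> e * m + C * (\<delta> * m)"
    using \<open>C \<ge> 0\<close> D by (intro add_left_mono mult_left_mono)
  also have "\<dots> = (e + C * \<delta>) * m" by (simp add: algebra_simps)
  \<comment> \<open>There are m jumps but m + 1 points, and the empirical average divides by the
    latter.\<close>
  also have "\<dots> \<le> (e + C * \<delta>) * Suc m"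
    using \<open>C \<ge> 0\<close> \<open>e \<ge> 0\<close> \<delta> by (intro mult_left_mono) auto
  finally have "\<bar>(\<Sum>i<Suc m. g (T (x i))) - (\<Sum>i<Suc m. g (x i))\<bar> \<le> (e + C * \<delta>) * Suc m + 2 * B" by simp
  then have "\<bar>(\<Sum>i<Suc m. g (T (x i))) - (\<Sum>i<Suc m. g (x i))\<bar> / Suc m \<le> ((e + C * \<delta>) * Suc m + 2 * B) / Suc m"
    by (intro divide_right_mono) auto
  also have "\<dots> = e + C * \<delta> + 2 * B / Suc m" by (simp add: add_divide_distrib)
  finally show ?thesis
    unfolding empirical_def diff_divide_distrib[symmetric] abs_divide by simp
qed

text \<open>Each property involves finitely many continuous functions, at which one empirical
  average approximates \<Lambda> simultaneously. Linearity, positivity and normalization hold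
  exactly for averages with n > 0; invariance holds up to an error that vanishes for large n and
  small \<delta>.\<close>

lemma functional_of_empirical_limits:
  fixes T :: "'a::metric_space \<Rightarrow> 'a"
  assumes "tds T"
    and freq: "\<And>L \<delta>. finite L \<Longrightarrow> (\<forall>g\<in>L. continuous_on UNIV g) \<Longrightarrow> \<delta> > 0 \<Longrightarrow>
       \<exists>\<^sub>F n in sequentially. pseudo_orbits_near_functional T n \<delta> \<Lambda> L \<noteq> {}"
  shows "normalized_positive_functional \<Lambda>"
    and "\<And>g. continuous_on UNIV g \<Longrightarrow> \<Lambda> (\<lambda>x. g (T x)) = \<Lambda> g"
proof -
  have cpt: "compact (UNIV :: 'a set)" and T: "continuous_on UNIV T"
    using assms by (auto simp: tds_def)
  have approx: "\<exists>n\<ge>N. \<exists>x\<in>avg_pseudo_orbits T n \<delta>. \<forall>g\<in>L. \<bar>empirical n x g - \<Lambda> g\<bar> \<le> \<delta>"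
    if L: "finite L" "\<forall>g\<in>L. continuous_on UNIV g" "\<delta> > 0" for L \<delta> N
  proof -
    obtain n where "n \<ge> N" "pseudo_orbits_near_functional T n \<delta> \<Lambda> L \<noteq> {}"
      using freq[OF L] unfolding frequently_sequentially by blast
    then show ?thesis unfolding pseudo_orbits_near_functional_def by blast
  qed
  show "normalized_positive_functional \<Lambda>"
  proof
    show "compact (UNIV :: 'a set)" by (rule cpt)
  next
    fix f g :: "'a \<Rightarrow> real" assume fg: "continuous_on UNIV f" "continuous_on UNIV g"
    let ?h = "\<lambda>x. f x + g x"
    have "\<bar>\<Lambda> ?h - (\<Lambda> f + \<Lambda> g)\<bar> \<le> e" if "e > 0" for e
    proof -
      have "\<forall>h\<in>{f, g, ?h}. continuous_on UNIV h" using fg by (simp add: continuous_on_add)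
      then obtain n x where "\<forall>h\<in>{f, g, ?h}. \<bar>empirical n x h - \<Lambda> h\<bar> \<le> e / 3"
        using approx[of "{f, g, ?h}" "e / 3" 0] \<open>e > 0\<close> by auto
      then have "\<bar>empirical n x f - \<Lambda> f\<bar> \<le> e / 3" "\<bar>empirical n x g - \<Lambda> g\<bar> \<le> e / 3"
          "\<bar>empirical n x ?h - \<Lambda> ?h\<bar> \<le> e / 3"
        by auto
      moreover have "empirical n x ?h = empirical n x f + empirical n x g"
        by (simp add: empirical_def sum.distrib add_divide_distrib)
      ultimately show ?thesis by linarith
    qed
    then have "\<Lambda> ?h - (\<Lambda> f + \<Lambda> g) = 0" by (rule dense_eq0_I)
    then show "\<Lambda> ?h = \<Lambda> f + \<Lambda> g" by simp
  next
    fix f :: "'a \<Rightarrow> real" and c assume f: "continuous_on UNIV f"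
    let ?h = "\<lambda>x. c * f x"
    have "\<bar>\<Lambda> ?h - c * \<Lambda> f\<bar> \<le> e" if "e > 0" for e
    proof -
      \<comment> \<open>The error at f is multiplied by |c| and the error at c f enters once, which
        together make e.\<close>
      let ?\<delta> = "e / (1 + \<bar>c\<bar>)"
      have c: "1 + \<bar>c\<bar> > 0" by simp
      then have \<delta>: "?\<delta> > 0" using \<open>e > 0\<close> by (rule divide_pos_pos[rotated])
      have "\<forall>h\<in>{f, ?h}. continuous_on UNIV h" using f by (simp add: continuous_on_mult_left)
      then obtain n x where h: "\<forall>h\<in>{f, ?h}. \<bar>empirical n x h - \<Lambda> h\<bar> \<le> ?\<delta>"
        using approx[of "{f, ?h}" ?\<delta> 0, OF _ _ \<delta>] by auto
      have "empirical n x ?h = c * empirical n x f"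
        by (simp add: empirical_def sum_distrib_left)
      then have "\<Lambda> ?h - c * \<Lambda> f = c * (empirical n x f - \<Lambda> f) - (empirical n x ?h - \<Lambda> ?h)"
        by (simp add: algebra_simps)
      also have "\<bar>\<dots>\<bar> \<le> \<bar>c\<bar> * \<bar>empirical n x f - \<Lambda> f\<bar> + \<bar>empirical n x ?h - \<Lambda> ?h\<bar>"
        by (rule order.trans[OF abs_triangle_ineq4]) (simp add: abs_mult)
      also have "\<dots> \<le> \<bar>c\<bar> * ?\<delta> + ?\<delta>"
        using h by (intro add_mono mult_left_mono) auto
      also have "\<dots> = (1 + \<bar>c\<bar>) * ?\<delta>"
        by (simp only: distrib_right mult_1 add.commute)
      also have "\<dots> = e" using c by simp
      finally show ?thesis .
    qed
    then have "\<Lambda> ?h - c * \<Lambda> f = 0" by (rule dense_eq0_I)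
    then show "\<Lambda> ?h = c * \<Lambda> f" by simp
  next
    fix f :: "'a \<Rightarrow> real" assume f: "continuous_on UNIV f" "\<And>x. 0 \<le> f x"
    show "0 \<le> \<Lambda> f"
    proof (rule field_le_epsilon)
      fix e :: real assume "0 < e"
      then obtain n x where "\<bar>empirical n x f - \<Lambda> f\<bar> \<le> e"
        using approx[of "{f}" e 0] f by auto
      moreover have "0 \<le> empirical n x f"
        unfolding empirical_def using f by (intro divide_nonneg_nonneg sum_nonneg) auto
      ultimately show "0 \<le> \<Lambda> f + e" by linarith
    qed
  next
    let ?h = "\<lambda>_ :: 'a. 1 :: real"
    have "\<bar>\<Lambda> ?h - 1\<bar> \<le> e" if "e > 0" for e
    proof -
      \<comment> \<open>n = 0 must be avoided: division by 0 would make the average of the constant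
        1 equal to 0.\<close>
      obtain n x where "n \<ge> 1" "\<bar>empirical n x ?h - \<Lambda> ?h\<bar> \<le> e"
        using approx[of "{?h}" e 1] \<open>e > 0\<close> by auto
      then show ?thesis by (simp add: empirical_def abs_minus_commute)
    qed
    then have "\<Lambda> ?h - 1 = 0" by (rule dense_eq0_I)
    then show "\<Lambda> ?h = 1" by simp
  qed
  fix g :: "'a \<Rightarrow> real" assume g: "continuous_on UNIV g"
  let ?h = "\<lambda>x. g (T x)"
  have hc: "continuous_on UNIV ?h"
    using continuous_on_compose2[OF g T] by simp
  obtain B where B: "\<And>x. \<bar>g x\<bar> \<le> B"
    using compact_imp_bounded[OF compact_continuous_image[OF g cpt]] by (auto simp: bounded_iff)
  have "\<bar>\<Lambda> ?h - \<Lambda> g\<bar> \<le> e" if e: "e > 0" for e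
  proof -
    obtain C where C: "C \<ge> 0" "\<And>a b. \<bar>g a - g b\<bar> \<le> e / 3 + C * dist a b"
      using continuous_le_dist[OF cpt g, of "e / 3"] e by auto
    \<comment> \<open>The error budget has three thirds of e: the modulus of g; C \<delta> from the
      jumps plus 2 \<delta> for replacing two averages by \<Lambda>; and the boundary term 2 B / n,
      made small by N.\<close>
    define \<delta> where "\<delta> = e / (3 * (C + 2))"
    have \<delta>: "\<delta> > 0" "(C + 2) * \<delta> = e / 3" using e C(1) by (auto simp: \<delta>_def field_simps)
    obtain N :: nat where N: "2 * B / (e / 3) < N" using reals_Archimedean2 by blast
    obtain n x where n: "n \<ge> N + 2" and x: "x \<in> avg_pseudo_orbits T n \<delta>"
        and near: "\<forall>h\<in>{g, ?h}. \<bar>empirical n x h - \<Lambda> h\<bar> \<le> \<delta>"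
      using approx[of "{g, ?h}" \<delta> "N + 2"] g hc \<delta>(1) by auto
    obtain m where m: "n = Suc m" "m > 0" using n by (cases n) auto
    have "2 * B / (e / 3) < Suc m" using N n m(1) by linarith
    then have "2 * B / Suc m \<le> e / 3" using e by (simp add: field_simps)
    moreover have "\<bar>empirical n x ?h - empirical n x g\<bar> \<le> e / 3 + C * \<delta> + 2 * B / Suc m"
      using empirical_compose_diff[OF x[unfolded m(1)] m(2) C(1) _ C(2) B] e m(1) by simp
    moreover have "\<bar>empirical n x g - \<Lambda> g\<bar> \<le> \<delta>" "\<bar>empirical n x ?h - \<Lambda> ?h\<bar> \<le> \<delta>"
      using near by auto
    moreover have "C * \<delta> + 2 * \<delta> = e / 3" using \<delta>(2) by (simp add: algebra_simps)
    ultimately show ?thesis by linarith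
  qed
  then have "\<Lambda> ?h - \<Lambda> g = 0" by (rule dense_eq0_I)
  then show "\<Lambda> ?h = \<Lambda> g" by simp
qed

section \<open>From the surviving functional to a maximizing invariant measure\<close>

lemma avg_pseudo_orbits_near_eq:
  assumes "\<And>g. g \<in> L \<Longrightarrow> (LINT y|\<mu>. g y) = \<Lambda> g"
  shows "avg_pseudo_orbits_near T n \<delta> \<mu> L = pseudo_orbits_near_functional T n \<delta> \<Lambda> L"
  using assms by (auto simp: avg_pseudo_orbits_near_def pseudo_orbits_near_functional_def empirical_def)

lemma GP_measure_le_GP: "GP_measure T F \<U> \<mu> \<le> GP T F \<U>"
proof -
  have "GP_measure T F \<U> \<mu> \<le> (INF \<delta>\<in>{0<..}. GP_measure_at T F \<U> \<delta> \<mu> {})"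
    unfolding GP_measure_def by (intro INF_lower) auto
  also have "\<dots> = GP T F \<U>"
    by (simp add: GP_def GP_at_def GP_measure_at_def avg_pseudo_orbits_near_def)
  finally show ?thesis .
qed

theorem theorem1p1:
  fixes T :: "'a::metric_space \<Rightarrow> 'a"
    and F :: "nat \<Rightarrow> (nat \<Rightarrow> 'a) \<Rightarrow> real"
    and \<U> :: "'a set set"
  assumes "tds T"
    and "block_subadditive F"
    and "is_open_cover euclidean UNIV \<U>"
  shows "(\<exists>\<mu>\<in>inv_prob_measures T. GP T F \<U> = GP_measure T F \<U> \<mu>) \<and>
         (\<forall>\<mu>\<in>inv_prob_measures T. GP_measure T F \<U> \<mu> \<le> GP T F \<U>)"
proof -
  obtain \<Lambda> :: "('a \<Rightarrow> real) \<Rightarrow> real" where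
    ge: "\<And>L \<delta>. finite L \<Longrightarrow> (\<forall>g\<in>L. continuous_on UNIV g) \<Longrightarrow> \<delta> > 0 \<Longrightarrow> GP T F \<U> \<le>
       limsup (\<lambda>n. elog (cover_sum F \<U> n (pseudo_orbits_near_functional T n \<delta> \<Lambda> L)) / ereal (real n))"
    and freq: "\<And>L \<delta>. finite L \<Longrightarrow> (\<forall>g\<in>L. continuous_on UNIV g) \<Longrightarrow> \<delta> > 0 \<Longrightarrow>
       \<exists>\<^sub>F n in sequentially. pseudo_orbits_near_functional T n \<delta> \<Lambda> L \<noteq> {}"
    using exists_functional[OF assms(1), where F = F and \<U> = \<U>] by blast
  interpret normalized_positive_functional \<Lambda>
    by (rule functional_of_empirical_limits(1)[OF assms(1) freq])
  note inv = functional_of_empirical_limits(2)[OF assms(1) freq]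
  let ?\<mu> = representing_measure
  have T: "continuous_on UNIV T" using assms(1) by (simp add: tds_def)
  have Tm: "T \<in> measurable ?\<mu> borel"
    using borel_measurable_continuous_onI[OF T] by (simp add: measurable_cong_sets[OF sets_representing_measure refl])
  have "distr ?\<mu> borel T = ?\<mu>"
  proof (rule prob_measure_eqI_continuous)
    show "prob_space (distr ?\<mu> borel T)"
      using Tm by (rule prob_space.prob_space_distr[OF prob_space_representing_measure])
    fix f :: "'a \<Rightarrow> real" assume f: "continuous_on UNIV f"
    have fT: "continuous_on UNIV (\<lambda>x. f (T x))"
      using continuous_on_compose2[OF f T] by simp
    have "(LINT x|distr ?\<mu> borel T. f x) = (LINT x|?\<mu>. f (T x))"
      using Tm borel_measurable_continuous_onI[OF f] by (rule integral_distr)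
    then show "(LINT x|distr ?\<mu> borel T. f x) = (LINT x|?\<mu>. f x)"
      by (simp add: integral_representing_measure f fT inv)
  qed (simp_all add: sets_representing_measure prob_space_representing_measure)
  then have \<mu>: "?\<mu> \<in> inv_prob_measures T"
    by (simp add: inv_prob_measures_def sets_representing_measure prob_space_representing_measure)
  have "GP T F \<U> \<le> GP_measure T F \<U> ?\<mu>"
    unfolding GP_measure_def GP_measure_at_def
  proof (intro INF_greatest)
    fix L :: "('a \<Rightarrow> real) set" and \<delta> :: real
    assume L: "L \<in> {L. finite L \<and> (\<forall>g\<in>L. continuous_on UNIV g)}" and "\<delta> \<in> {0<..}"
    \<comment> \<open>Integration agrees exactly with \<Lambda> on continuous functions, so the two
      sets coincide and the bound transfers without any loss in \<delta>.\<close>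
    have "avg_pseudo_orbits_near T n \<delta> ?\<mu> L = pseudo_orbits_near_functional T n \<delta> \<Lambda> L" for n
      using L by (intro avg_pseudo_orbits_near_eq integral_representing_measure) auto
    then show "GP T F \<U> \<le> limsup (\<lambda>n. elog (cover_sum F \<U> n (avg_pseudo_orbits_near T n \<delta> ?\<mu> L)) / ereal (real n))"
      using ge[of L \<delta>] L \<open>\<delta> \<in> {0<..}\<close> by simp
  qed
  then have "GP T F \<U> = GP_measure T F \<U> ?\<mu>"
    using GP_measure_le_GP by (rule antisym)
  with \<mu> GP_measure_le_GP show ?thesis by blast
qed

end
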